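(* Let $d\ge1$, $\alpha<1$, let $\mathbf F:S^{d-1}\to\mathbb R^d$ be continuously differentiable, and let $\mathbf G$ be a regularization function as in the context. Let $\mathbf y_*\in S^{d-1}$ be a fixed-point attractor of $d\tilde{\mathbf y}/ds=\mathbf F_s(\tilde{\mathbf y})$ (so $\mathbf F_s(\mathbf y_* )=\mathbf 0$) with $F_r(\mathbf y_* )<0$. Let $\mathbf x^\nu(t)$, $\nu>0$, be the solution of the $\nu$-regularized problem $\dot{\mathbf x}=\mathbf f^\nu(\mathbf x)$ with initial condition $\mathbf x^\nu(t_0)=\mathbf x_0=r_0\mathbf y_0$, where $r_0>0$ and $\mathbf y_0\in\mathcal B(\{\mathbf y_*\})$, and let $t_b$ be the (finite) blowup time of the solution of the singular system with the same initial condition. (a) If the regularization is locally trapping, then $\lim_{\nu\to0}\mathbf x^\nu(t)=\mathbf 0$ for all $t>t_b$. (b) Suppose the regularization is locally expelling. Let $t_1>t_b$ and let $\nu_n\to0$ be a sequence such that $\mathbf x^{\nu_n}(t)\to\mathbf x(t)$ uniformly on $[t_b,t_1]$. Let $\mathbf y_*^{esc}\in\mathcal B(\mathcal A')$ for a defocusing attractor $\mathcal A'$ of the system $d\tilde{\mathbf Y}/dS=\mathbf F_s(\tilde{\mathbf Y})$ on $S^{d-1}$. Assume additionally that every solution $\tilde{\mathbf Y}(S)$ of this system starting (at $S=0$) in some neighborhood of $\mathbf y_*^{esc}$ satisfies $$\limsup_{S\to\infty}\int_0^S\exp\left[-(1-\alpha)\int_{S'}^SF_r(\tilde{\mathbf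 Y}(S''))\,dS''\right]dS'<\infty .$$ Then $r(t)=|\mathbf x(t)|>0$ and $\mathbf y(t)=\mathbf x(t)/r(t)\in\mathcal A'$ for all $t\in(t_b,t_1]$.
   Context: The singular system is $\dot{\mathbf x}=\mathbf f(\mathbf x)=r^\alpha\mathbf F(\mathbf y)$, $r=|\mathbf x|$, $\mathbf y=\mathbf x/r$. Decompose $\mathbf F(\mathbf y)=F_r(\mathbf y)\,\mathbf y+\mathbf F_s(\mathbf y)$ with $F_r(\mathbf y)=\mathbf F(\mathbf y)\cdot\mathbf y$. The blowup time $t_b$ is the maximal time such that the solution of the singular system with $\mathbf x(t_0)=\mathbf x_0$ satisfies $\mathbf x(t)\ne\mathbf 0$ on $[t_0,t_b)$. Regularization: $\mathbf G$ is an $\mathbb R^d$-valued function on the closed unit ball such that for every $\nu>0$ the field $$\mathbf f^\nu(\mathbf x)=\begin{cases}r^\alpha\mathbf F(\mathbf x/r),& r>\nu,\\ \nu^\alpha\mathbf G(\mathbf x/\nu),& r\le\nu,\end{cases}$$ is continuously differentiable on $\mathbb R^d$. Then $\mathbf x^\nu(t)$ exists and is unique globally in time. Rescaled problem: for $\mathbf y_{ent}\in S^{d-1}$ let $\mathbf X(\tau)$ be the unique global solution of $$\frac{d\mathbf X}{d\tau}=\begin{cases}R^\alpha\mathbf F(\mathbf X/R),&R>1,\\ \mathbf G(\mathbf X),&R\le1,\end{cases}\qquad \mathbf X(\tau_{ent})=\mathbf y_{ent},\quad R=|\mathbf X|,$$ with $\tau_{ent}=-\frac{1}{F_r(\mathbf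 y_* )(\alpha-1)}$. Such a solution is expelled if there is a finite $\tau_{esc}>\tau_{ent}$ with $R(\tau_{esc})=1$ and $R(\tau)>1$ for all $\tau>\tau_{esc}$; its exit point is $\mathbf y_{esc}=\mathbf X(\tau_{esc})$. It is trapped with bound $R_b<\infty$ if $R(\tau)\le1$ for arbitrarily large $\tau$ and $R(\tau)\le R_b$ for all $\tau>\tau_{ent}$. The regularization is locally expelling if for all $\mathbf y_{ent}$ in some neighborhood of $\mathbf y_*$ in $S^{d-1}$ the solution is expelled and, additionally, $\mathbf y_{esc}$ depends smoothly (continuously differentiably) on $\mathbf y_{ent}$; $\mathbf y_*^{esc}$ denotes the exit point of the solution with $\mathbf y_{ent}=\mathbf y_*$. It is locally trapping if for all $\mathbf y_{ent}$ in some neighborhood of $\mathbf y_*$ in $S^{d-1}$ the solution is trapped with the same bound $R_b$. An attractor of $d\tilde{\mathbf Y}/dS=\mathbf F_s(\tilde{\mathbf Y})$ is a nonempty compact invariant set $\mathcal A\subset S^{d-1}$ that has a neighborhood $U_0$ with $\bigcap_{S\ge0}U_S=\mathcal A$, where $U_S$ is the image of $U_0$ under the time-$S$ flow. Its basin $\mathcal B(\mathcal A)$ is the set of all points whose trajectories approach $\mathcal A$ asymptotically as $S\to\infty$. A fixed-point attractor is an attractor consisting of a single point. An attractor $\mathcal A$ is defocusing if for every solution $\tilde{\mathbf Y}$ starting in $\mathcal B(\mathcal A)$ one has $\liminf_{S\to\infty}\frac1S\int_0^SF_r(\tilde{\mathbf Y}(S'))\,dS'>0$. *)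

theory Defs
  imports "HOL-Analysis.Analysis"
begin

(* Continuous differentiability on an arbitrary set S, by local C^1 extensions.  For S = UNIV
   (or S open) this is the usual notion; for relatively open subsets of the unit sphere it is
   the usual notion on the submanifold, and it does not depend on values outside S. *)
definition C1_on :: "'a::real_normed_vector set \<Rightarrow> ('a \<Rightarrow> 'b::real_normed_vector) \<Rightarrow> bool" where
  "C1_on S f \<longleftrightarrow>
     (\<forall>x\<in>S. \<exists>U g. \<exists>g' :: 'a \<Rightarrow> 'a \<Rightarrow>\<^sub>L 'b. open U \<and> x \<in> U \<and>
        (\<forall>y\<in>U. (g has_derivative blinfun_apply (g' y)) (at y)) \<and> continuous_on U g' \<and>
        (\<forall>y\<in>U \<inter> S. g y = f y))"

definition solves_ivp ::
  "('a::real_normed_vector \<Rightarrow> 'a) \<Rightarrow> real \<Rightarrow> 'a \<Rightarrow> real set \<Rightarrow> (real \<Rightarrow> 'a) \<Rightarrow> bool" where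
  "solves_ivp f t0 x0 T x \<longleftrightarrow>
     x t0 = x0 \<and> (\<forall>t\<in>T. (x has_vector_derivative f (x t)) (at t within T))"

(* The angular field F is a total function, but only its values on the unit sphere are used. *)

definition Fr :: "(real^'n \<Rightarrow> real^'n) \<Rightarrow> real^'n \<Rightarrow> real" where
  "Fr F y = F y \<bullet> y"

definition Fs :: "(real^'n \<Rightarrow> real^'n) \<Rightarrow> real^'n \<Rightarrow> real^'n" where
  "Fs F y = F y - Fr F y *\<^sub>R y"

definition singular_field :: "real \<Rightarrow> (real^'n \<Rightarrow> real^'n) \<Rightarrow> real^'n \<Rightarrow> real^'n" where
  "singular_field \<alpha> F x = norm x powr \<alpha> *\<^sub>R F (x /\<^sub>R norm x)"

definition regularized_field ::
  "real \<Rightarrow> (real^'n \<Rightarrow> real^'n) \<Rightarrow> (real^'n \<Rightarrow> real^'n) \<Rightarrow> real \<Rightarrow> real^'n \<Rightarrow> real^'n" where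
  "regularized_field \<alpha> F G \<nu> x =
     (if norm x > \<nu> then singular_field \<alpha> F x else \<nu> powr \<alpha> *\<^sub>R G (x /\<^sub>R \<nu>))"

definition rescaled_field ::
  "real \<Rightarrow> (real^'n \<Rightarrow> real^'n) \<Rightarrow> (real^'n \<Rightarrow> real^'n) \<Rightarrow> real^'n \<Rightarrow> real^'n" where
  "rescaled_field \<alpha> F G X = (if norm X > 1 then singular_field \<alpha> F X else G X)"

definition nonzero_singular_solution ::
  "real \<Rightarrow> (real^'n \<Rightarrow> real^'n) \<Rightarrow> real \<Rightarrow> real^'n \<Rightarrow> real \<Rightarrow> (real \<Rightarrow> real^'n) \<Rightarrow> bool" where
  "nonzero_singular_solution \<alpha> F t0 x0 T x \<longleftrightarrow>
     solves_ivp (singular_field \<alpha> F) t0 x0 {t0..<T} x \<and> (\<forall>t\<in>{t0..<T}. x t \<noteq> 0)"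

(* A real number tb with this property exists only if the blowup time is finite. *)
definition is_blowup_time ::
  "real \<Rightarrow> (real^'n \<Rightarrow> real^'n) \<Rightarrow> real \<Rightarrow> real^'n \<Rightarrow> real \<Rightarrow> bool" where
  "is_blowup_time \<alpha> F t0 x0 tb \<longleftrightarrow>
     t0 < tb \<and> (\<exists>x. nonzero_singular_solution \<alpha> F t0 x0 tb x) \<and>
     (\<forall>T>tb. \<not> (\<exists>x. nonzero_singular_solution \<alpha> F t0 x0 T x))"

definition tau_ent :: "real \<Rightarrow> (real^'n \<Rightarrow> real^'n) \<Rightarrow> real^'n \<Rightarrow> real" where
  "tau_ent \<alpha> F ystar = - (1 / (Fr F ystar * (\<alpha> - 1)))"

definition rescaled_solution ::
  "real \<Rightarrow> (real^'n \<Rightarrow> real^'n) \<Rightarrow> (real^'n \<Rightarrow> real^'n) \<Rightarrow> real^'n \<Rightarrow> real^'n \<Rightarrow>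
   (real \<Rightarrow> real^'n) \<Rightarrow> bool" where
  "rescaled_solution \<alpha> F G ystar yent X \<longleftrightarrow>
     solves_ivp (rescaled_field \<alpha> F G) (tau_ent \<alpha> F ystar) yent {tau_ent \<alpha> F ystar..} X"

(* The solution entering at yent is expelled, with exit point yesc.  The escape time, if it
   exists, is unique, since norm X = 1 there and norm X > 1 at all later times. *)
definition expelled_at ::
  "real \<Rightarrow> (real^'n \<Rightarrow> real^'n) \<Rightarrow> (real^'n \<Rightarrow> real^'n) \<Rightarrow> real^'n \<Rightarrow> real^'n \<Rightarrow> real^'n \<Rightarrow> bool" where
  "expelled_at \<alpha> F G ystar yent yesc \<longleftrightarrow>
     (\<exists>X \<tau>esc. rescaled_solution \<alpha> F G ystar yent X \<and>
        tau_ent \<alpha> F ystar < \<tau>esc \<and> norm (X \<tau>esc) = 1 \<and> (\<forall>\<tau>>\<tau>esc. norm (X \<tau>) > 1) \<and>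
        yesc = X \<tau>esc)"

definition trapped ::
  "real \<Rightarrow> (real^'n \<Rightarrow> real^'n) \<Rightarrow> (real^'n \<Rightarrow> real^'n) \<Rightarrow> real^'n \<Rightarrow> real^'n \<Rightarrow> real \<Rightarrow> bool" where
  "trapped \<alpha> F G ystar yent Rb \<longleftrightarrow>
     (\<exists>X. rescaled_solution \<alpha> F G ystar yent X \<and>
        (\<exists>\<^sub>F \<tau> in at_top. norm (X \<tau>) \<le> 1) \<and> (\<forall>\<tau>>tau_ent \<alpha> F ystar. norm (X \<tau>) \<le> Rb))"

definition locally_expelling ::
  "real \<Rightarrow> (real^'n \<Rightarrow> real^'n) \<Rightarrow> (real^'n \<Rightarrow> real^'n) \<Rightarrow> real^'n \<Rightarrow> bool" where
  "locally_expelling \<alpha> F G ystar \<longleftrightarrow>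
     (\<exists>V esc. openin (top_of_set (sphere 0 1)) V \<and> ystar \<in> V \<and> C1_on V esc \<and>
        (\<forall>yent\<in>V. expelled_at \<alpha> F G ystar yent (esc yent)))"

definition locally_trapping ::
  "real \<Rightarrow> (real^'n \<Rightarrow> real^'n) \<Rightarrow> (real^'n \<Rightarrow> real^'n) \<Rightarrow> real^'n \<Rightarrow> bool" where
  "locally_trapping \<alpha> F G ystar \<longleftrightarrow>
     (\<exists>V Rb. openin (top_of_set (sphere 0 1)) V \<and> ystar \<in> V \<and>
        (\<forall>yent\<in>V. trapped \<alpha> F G ystar yent Rb))"

(* Forward solutions of dY/dS = F_s(Y) on the unit sphere. *)
definition sphere_solution :: "(real^'n \<Rightarrow> real^'n) \<Rightarrow> (real \<Rightarrow> real^'n) \<Rightarrow> bool" where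
  "sphere_solution F Y \<longleftrightarrow> (\<forall>S\<ge>0. Y S \<in> sphere 0 1) \<and> solves_ivp (Fs F) 0 (Y 0) {0..} Y"

(* The image of U under the time-S flow, S \<ge> 0; for F of class C^1 solutions through each
   point of the sphere exist and are unique. *)
definition flow_image :: "(real^'n \<Rightarrow> real^'n) \<Rightarrow> real \<Rightarrow> (real^'n) set \<Rightarrow> (real^'n) set" where
  "flow_image F S U = {Y S | Y. sphere_solution F Y \<and> Y 0 \<in> U}"

definition attractor :: "(real^'n \<Rightarrow> real^'n) \<Rightarrow> (real^'n) set \<Rightarrow> bool" where
  "attractor F A \<longleftrightarrow>
     A \<noteq> {} \<and> compact A \<and> A \<subseteq> sphere 0 1 \<and> (\<forall>S\<ge>0. flow_image F S A = A) \<and>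
     (\<exists>U0 V. openin (top_of_set (sphere 0 1)) V \<and> A \<subseteq> V \<and> V \<subseteq> U0 \<and> U0 \<subseteq> sphere 0 1 \<and>
        (\<Inter>S\<in>{0..}. flow_image F S U0) = A)"

definition basin :: "(real^'n \<Rightarrow> real^'n) \<Rightarrow> (real^'n) set \<Rightarrow> (real^'n) set" where
  "basin F A = {Y 0 | Y. sphere_solution F Y \<and> ((\<lambda>S. infdist (Y S) A) \<longlongrightarrow> 0) at_top}"

definition defocusing :: "(real^'n \<Rightarrow> real^'n) \<Rightarrow> (real^'n) set \<Rightarrow> bool" where
  "defocusing F A \<longleftrightarrow>
     (\<forall>Y. sphere_solution F Y \<and> Y 0 \<in> basin F A \<longrightarrow>
        Liminf at_top (\<lambda>S. ereal (1 / S * integral {0..S} (\<lambda>S'. Fr F (Y S')))) > 0)"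

end

theory Submission
  imports Defs
begin

text \<open>In the angular time \<open>S\<close> a solution outside the ball of radius \<open>\<nu>\<close> has the form \<open>R S *\<^sub>R Y S\<close>,
  where \<open>Y\<close> solves the angular system on the sphere, \<open>R\<close> is the exponential of the integral of
  \<open>Fr F\<close> along \<open>Y\<close>, and the physical time is the integral of \<open>R powr (1 - \<alpha>)\<close>. Towards \<open>ystar\<close> the
  radius decays, so the regularized solution reaches the sphere of radius \<open>\<nu>\<close> no later than \<open>tb\<close>, at
  a direction close to \<open>ystar\<close>; from there on it is a rescaled solution, at scale \<open>\<nu>\<close>. If that is
  trapped, the solution stays of size \<open>O(\<nu>)\<close>.

  If the rescaled solution from \<open>ystar\<close> is expelled, it comes arbitrarily close to \<open>A'\<close> in direction
  with a large radius, and by continuous dependence so do the nearby ones. An attractor is stable,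
  and by compactness of \<open>A'\<close> the defocusing condition gives \<open>c * (S - s) - M\<close> as a lower bound for the
  integral of \<open>Fr F\<close> over \<open>{s..S}\<close>, uniformly for all solutions staying near \<open>A'\<close>. Hence the nearby
  rescaled solutions never return to the unit ball, keep a direction near \<open>A'\<close>, and satisfy
  \<open>elapsed time \<le> C * R powr (1 - \<alpha>)\<close>. Scaling back, \<open>norm (x\<nu> \<nu> t)\<close> stays away from \<open>0\<close> for \<open>t > tb\<close>
  as \<open>\<nu> \<rightarrow> 0\<close>.\<close>

section \<open>Differential equations with locally Lipschitz fields\<close>

text \<open>Near each point of \<open>K\<close> the derivative of the local C1 extension is bounded
  by continuity, so the mean value inequality on a small ball gives a local Lipschitz constant;
  compactness of \<open>K\<close> turns these into a single one. The time argument of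
  \<open>local_lipschitz\<close> is a dummy ranging over \<open>{0}\<close>.\<close>

lemma C1_on_lipschitz_on_compact:
  assumes "C1_on S f" "compact K" "K \<subseteq> S"
  obtains L where "L-lipschitz_on K f"
proof -
  have "local_lipschitz {0::real} K (\<lambda>_. f)"
  proof (rule local_lipschitzI)
    fix t :: real and x
    assume "x \<in> K"
    then have "x \<in> S" using assms by auto
    with assms(1) obtain U g and g' :: "'a \<Rightarrow> 'a \<Rightarrow>\<^sub>L 'b" where U: "open U" "x \<in> U"
      and der: "\<And>y. y \<in> U \<Longrightarrow> (g has_derivative blinfun_apply (g' y)) (at y)"
      and cont: "continuous_on U g'" and eq: "\<And>y. y \<in> U \<inter> S \<Longrightarrow> g y = f y"
      unfolding C1_on_def by meson
    have "\<forall>\<^sub>F y in nhds x. y \<in> U \<and> dist (g' y) (g' x) < 1"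
      using U cont
      by (intro eventually_conj eventually_nhds_in_open tendstoD)
        (auto simp: continuous_on_eq_continuous_at isCont_def tendsto_at_iff_tendsto_nhds)
    then obtain u0 where u0: "u0 > 0" "\<And>y. dist y x < u0 \<Longrightarrow> y \<in> U \<and> dist (g' y) (g' x) < 1"
      unfolding eventually_nhds_metric by blast
    define u where "u = u0 / 2"
    have u: "u > 0" "\<And>y. y \<in> cball x u \<Longrightarrow> y \<in> U \<and> dist (g' y) (g' x) < 1"
      using u0 by (auto simp: u_def dist_commute)
    have "(norm (g' x) + 1)-lipschitz_on (cball x u \<inter> K) f"
    proof (rule lipschitz_onI)
      fix y z assume yz: "y \<in> cball x u \<inter> K" "z \<in> cball x u \<inter> K"
      have "norm (g y - g z) \<le> (norm (g' x) + 1) * norm (y - z)"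
      proof (rule differentiable_bound[where S = "cball x u" and f' = "\<lambda>y. blinfun_apply (g' y)"])
        fix w assume w: "w \<in> cball x u"
        show "(g has_derivative blinfun_apply (g' w)) (at w within cball x u)"
          using der u(2)[OF w] has_derivative_at_withinI by blast
        have "norm (g' w) \<le> norm (g' x) + dist (g' w) (g' x)"
          by (simp add: dist_norm norm_triangle_sub)
        then show "onorm (blinfun_apply (g' w)) \<le> norm (g' x) + 1"
          using u(2)[OF w] by (simp flip: norm_blinfun.rep_eq)
      qed (use yz in auto)
      moreover have "g y = f y" "g z = f z"
        using yz u(2) eq assms(3) by auto
      ultimately show "dist (f y) (f z) \<le> (norm (g' x) + 1) * dist y z"
        by (simp add: dist_norm)
    qed auto
    then show "\<exists>u>0. \<exists>L. \<forall>t\<in>cball t u \<inter> {0}. L-lipschitz_on (cball x u \<inter> K) f"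
      using u(1) by blast
  qed
  from local_lipschitz_compact_implies_lipschitz[OF this assms(2)] obtain L where
    "\<And>t. t \<in> {0::real} \<Longrightarrow> L-lipschitz_on K f" by auto
  then show thesis using that by blast
qed

text \<open>The squared distance, damped by \<open>exp (- 2 * K * (t - a))\<close>, does not
  increase. The bound by \<open>K\<close> is assumed only along the two curves, so fields that are
  Lipschitz merely on a sphere or on a ball are covered.\<close>

lemma gronwall_dist:
  fixes x y :: "real \<Rightarrow> 'a::real_inner"
  assumes "a \<le> b"
    and x: "\<And>t. t \<in> {a..b} \<Longrightarrow> (x has_vector_derivative x' t) (at t within {a..b})"
    and y: "\<And>t. t \<in> {a..b} \<Longrightarrow> (y has_vector_derivative y' t) (at t within {a..b})"
    and K: "\<And>t. t \<in> {a..b} \<Longrightarrow> norm (x' t - y' t) \<le> K * norm (x t - y t)"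
  shows "norm (x b - y b) \<le> exp (K * (b - a)) * norm (x a - y a)"
proof -
  define w where "w = (\<lambda>t. x t - y t)"
  define h where "h = (\<lambda>t. (w t \<bullet> w t) * exp (- 2 * K * (t - a)))"
  have w: "(w has_vector_derivative (x' t - y' t)) (at t within {a..b})" if "t \<in> {a..b}" for t
    unfolding w_def using x[OF that] y[OF that] by (rule has_vector_derivative_diff)
  have hd: "(h has_real_derivative (2 * (w t \<bullet> (x' t - y' t)) - 2 * K * (w t \<bullet> w t))
      * exp (- 2 * K * (t - a))) (at t within {a..b})" if "t \<in> {a..b}" for t
  proof -
    have "((\<lambda>t. w t \<bullet> w t) has_vector_derivative (w t \<bullet> (x' t - y' t) + (x' t - y' t) \<bullet> w t))
        (at t within {a..b})"
      using bounded_bilinear.has_vector_derivative[OF bounded_bilinear_inner w[OF that] w[OF that]] .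
    then have "((\<lambda>t. w t \<bullet> w t) has_real_derivative 2 * (w t \<bullet> (x' t - y' t)))
        (at t within {a..b})"
      by (simp add: has_real_derivative_iff_has_vector_derivative inner_commute)
    moreover have "((\<lambda>t. exp (- 2 * K * (t - a))) has_real_derivative
        exp (- 2 * K * (t - a)) * (- 2 * K)) (at t within {a..b})"
      by (auto intro!: derivative_eq_intros)
    ultimately show ?thesis
      unfolding h_def by (rule DERIV_mult[THEN DERIV_cong]) (simp add: algebra_simps)
  qed
  have "h b \<le> h a"
  proof (rule DERIV_nonpos_imp_decreasing_open[OF assms(1)])
    show "continuous_on {a..b} h"
      using hd by (rule DERIV_continuous_on)
    fix t assume t: "a < t" "t < b"
    have "w t \<bullet> (x' t - y' t) \<le> norm (w t) * norm (x' t - y' t)"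
      by (rule norm_cauchy_schwarz)
    also have "\<dots> \<le> norm (w t) * (K * norm (w t))"
      using K[of t] t by (intro mult_left_mono) (auto simp: w_def)
    also have "\<dots> = K * (w t \<bullet> w t)"
      by (simp add: dot_square_norm power2_eq_square)
    finally have "(2 * (w t \<bullet> (x' t - y' t)) - 2 * K * (w t \<bullet> w t)) * exp (- 2 * K * (t - a)) \<le> 0"
      by (intro mult_nonpos_nonneg) auto
    then show "\<exists>D. DERIV h t :> D \<and> D \<le> 0"
      using hd[of t] t by (auto simp: at_within_Icc_at)
  qed
  then have "norm (w b) ^ 2 * exp (2 * (- K * (b - a))) \<le> norm (w a) ^ 2"
    by (simp add: h_def dot_square_norm mult.assoc)
  then have "(norm (w b) * exp (- K * (b - a))) ^ 2 \<le> norm (w a) ^ 2"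
    unfolding exp_double power_mult_distrib .
  then have "norm (w b) * exp (- K * (b - a)) \<le> norm (w a)"
    by (rule power2_le_imp_le) simp
  then have "norm (w b) * exp (- K * (b - a)) * exp (K * (b - a)) \<le> norm (w a) * exp (K * (b - a))"
    by (rule mult_right_mono) simp
  then show ?thesis
    by (simp add: w_def mult.assoc mult.commute[of "norm (x a - y a)"] flip: exp_add)
qed

section \<open>Integrals from a fixed endpoint and first crossing times\<close>

lemma at_within_atLeast_eq:
  fixes t a :: real
  assumes "a \<le> t"
  shows "at t within {a..} = at t within {a..t + 1}"
  by (rule at_within_nhd[of _ "{..<t + 1}"]) auto

lemma integral_has_vector_derivative_atLeast:
  fixes f :: "real \<Rightarrow> 'a::banach"
  assumes "continuous_on {a..} f" "a \<le> t"
  shows "((\<lambda>u. integral {a..u} f) has_vector_derivative f t) (at t within {a..})"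
  unfolding at_within_atLeast_eq[OF assms(2)]
  by (rule integral_has_vector_derivative)
    (use assms in \<open>auto intro: continuous_on_subset\<close>)

text \<open>The set of times in \<open>{a..b}\<close> with \<open>c \<le> u t\<close> is closed, so
  its infimum belongs to it; the intermediate value theorem then forces equality at this
  time.\<close>

lemma first_hitting:
  fixes u :: "real \<Rightarrow> real"
  assumes cont: "continuous_on {a..b} u" and "a \<le> b" "u a < c" "c \<le> u b"
  obtains s where "a < s" "s \<le> b" "u s = c" "\<And>t. a \<le> t \<Longrightarrow> t < s \<Longrightarrow> u t < c"
proof -
  define T where "T = {t \<in> {a..b}. c \<le> u t}"
  have "closed T"
    using continuous_closed_preimage[OF cont, of "{c..}"] by (simp add: T_def vimage_def Int_def)
  moreover have "T \<noteq> {}" "bdd_below T"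
    using assms by (auto simp: T_def intro: bdd_belowI[of _ a])
  ultimately have "Inf T \<in> T"
    using closed_contains_Inf by blast
  define s where "s = Inf T"
  have s: "s \<in> {a..b}" "c \<le> u s"
    using \<open>Inf T \<in> T\<close> by (auto simp: T_def s_def)
  have below: "u t < c" if "a \<le> t" "t < s" for t
  proof (rule ccontr)
    assume "\<not> u t < c"
    then have "t \<in> T" using that s by (auto simp: T_def)
    then have "s \<le> t" unfolding s_def using \<open>bdd_below T\<close> by (rule cInf_lower)
    then show False using that by simp
  qed
  obtain p where p: "a \<le> p" "p \<le> s" "u p = c"
    using IVT'[of u a c s] s assms(3) continuous_on_subset[OF cont, of "{a..s}"] by force
  then have "p = s" using below[of p] by force
  then show thesis
    using that[of s] p s below assms(3) by force
qed

lemma lipschitz_ode_exists: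
  fixes H :: "'a::banach \<Rightarrow> 'a"
  assumes lip: "L-lipschitz_on UNIV H" and H0: "H 0 = 0"
  obtains x where "x 0 = y" "\<And>t. t \<ge> 0 \<Longrightarrow> (x has_vector_derivative H (x t)) (at t within {0..})"
proof -
  \<comment> \<open>Picard iteration for \<open>u t = exp (- K * t) *\<^sub>R x t\<close> is a contraction on all of \<open>{0..}\<close>.\<close>
  define K where "K = 2 * (L + 1)"
  have L: "0 \<le> L" using lip by (rule lipschitz_on_nonneg)
  then have K: "K > 0" by (simp add: K_def)
  have Hn: "norm (H p) \<le> L * norm p" for p
    using lipschitz_onD[OF lip, of p 0] by (simp add: H0 dist_norm)
  have Hc: "continuous_on A (\<lambda>s. H (g s))" if "continuous_on A g" for A :: "real set" and g
    using continuous_on_compose2[OF lipschitz_on_continuous_on[OF lip] that] by simp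
  define I where "I = (\<lambda>(u :: real \<Rightarrow>\<^sub>C 'a) t. integral {0..t} (\<lambda>s. H (exp (K * s) *\<^sub>R u s)))"
  \<comment> \<open>The elements of the complete space are functions on the whole line;
    \<open>max t 0\<close> extends the iterate to negative times by its value at 0.\<close>
  define \<Phi> where "\<Phi> = (\<lambda>u t. exp (- K * max t 0) *\<^sub>R (y + I u (max t 0)))"
  have contH: "continuous_on A (\<lambda>s. H (exp (K * s) *\<^sub>R u s))" for A and u :: "real \<Rightarrow>\<^sub>C 'a"
    by (intro Hc continuous_intros) auto
  have expint: "((\<lambda>s. C * exp (K * s)) has_integral C * (exp (K * t) - 1) / K) {0..t}"
    if "t \<ge> 0" for C t
  proof -
    have "((\<lambda>s. C * exp (K * s)) has_integral (C * exp (K * t) / K - C * exp (K * 0) / K)) {0..t}"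
      using K by (intro fundamental_theorem_of_calculus that)
        (auto intro!: derivative_eq_intros simp flip: has_real_derivative_iff_has_vector_derivative)
    then show ?thesis by (simp add: algebra_simps diff_divide_distrib)
  qed
  have Ider: "(I u has_vector_derivative H (exp (K * t) *\<^sub>R u t)) (at t within {0..})"
    if "t \<ge> 0" for u t
    unfolding I_def by (rule integral_has_vector_derivative_atLeast[OF contH that])
  \<comment> \<open>Integrating the weight \<open>exp (K * s)\<close> gains the factor
    \<open>1 / K\<close>, which is what makes the iteration contract.\<close>
  have bound: "norm (integral {0..t} f) \<le> C * exp (K * t) / K"
    if "t \<ge> 0" "continuous_on {0..t} f" "\<And>s. s \<in> {0..t} \<Longrightarrow> norm (f s) \<le> C * exp (K * s)" "C \<ge> 0"
    for f :: "real \<Rightarrow> 'a" and C t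
  proof -
    have "norm (integral {0..t} f) \<le> integral {0..t} (\<lambda>s. C * exp (K * s))"
      using that expint[OF that(1)]
      by (intro integral_norm_bound_integral integrable_continuous_real) (auto intro!: continuous_intros)
    also have "\<dots> = C * (exp (K * t) - 1) / K"
      using expint[OF that(1)] by (rule integral_unique)
    also have "\<dots> \<le> C * exp (K * t) / K"
      using that(4) K by (intro divide_right_mono mult_left_mono) auto
    finally show ?thesis .
  qed
  have bc: "\<Phi> u \<in> bcontfun" for u
  proof (rule bcontfun_normI)
    have "continuous_on {0..} (I u)"
      using Ider by (auto intro!: continuous_on_vector_derivative)
    then have "continuous_on UNIV (\<lambda>t. I u (max t 0))"
      by (rule continuous_on_compose2) (auto intro!: continuous_intros)
    then show "continuous_on UNIV (\<Phi> u)"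
      unfolding \<Phi>_def by (intro continuous_intros) auto
    fix t :: real
    let ?t = "max t 0"
    have "norm (I u ?t) \<le> L * norm u * exp (K * ?t) / K"
      unfolding I_def
    proof (rule bound)
      fix s assume "s \<in> {0..max t 0}"
      have "norm (H (exp (K * s) *\<^sub>R u s)) \<le> L * (exp (K * s) * norm (u s))"
        using Hn[of "exp (K * s) *\<^sub>R u s"] by simp
      also have "\<dots> \<le> L * (exp (K * s) * norm u)"
        using L by (intro mult_left_mono norm_bounded) auto
      finally show "norm (H (exp (K * s) *\<^sub>R u s)) \<le> L * norm u * exp (K * s)"
        by (simp add: mult_ac)
    qed (use L contH in auto)
    then have "exp (- K * ?t) * norm (I u ?t) \<le> exp (- K * ?t) * (L * norm u * exp (K * ?t) / K)"
      by (intro mult_left_mono) auto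
    also have "\<dots> = L * norm u / K"
      by (simp add: exp_minus field_simps)
    finally have 1: "exp (- K * ?t) * norm (I u ?t) \<le> L * norm u / K" .
    have "norm (\<Phi> u t) \<le> exp (- K * ?t) * (norm y + norm (I u ?t))"
      unfolding \<Phi>_def by (simp add: norm_triangle_ineq)
    also have "\<dots> \<le> norm y + L * norm u / K"
      using 1 K mult_right_mono[of "exp (- K * ?t)" 1 "norm y"] by (simp add: distrib_left)
    finally show "norm (\<Phi> u t) \<le> norm y + L * norm u / K" .
  qed
  have app: "apply_bcontfun (Bcontfun (\<Phi> u)) = \<Phi> u" for u
    by (rule Bcontfun_inverse[OF bc])
  have "\<exists>!u. Bcontfun (\<Phi> u) = u"
  proof (rule banach_fix_type[of "1/2"])
    show "\<forall>u v. dist (Bcontfun (\<Phi> u)) (Bcontfun (\<Phi> v)) \<le> 1 / 2 * dist u v"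
    proof (intro allI dist_bound)
      fix u v :: "real \<Rightarrow>\<^sub>C 'a" and t :: real
      let ?t = "max t 0"
      have "I u ?t - I v ?t = integral {0..?t} (\<lambda>s. H (exp (K * s) *\<^sub>R u s) - H (exp (K * s) *\<^sub>R v s))"
        unfolding I_def
        by (rule Henstock_Kurzweil_Integration.integral_diff[symmetric]) (intro integrable_continuous_real contH)+
      also have "norm \<dots> \<le> L * dist u v * exp (K * ?t) / K"
      proof (rule bound)
        fix s assume "s \<in> {0..max t 0}"
        have "norm (H (exp (K * s) *\<^sub>R u s) - H (exp (K * s) *\<^sub>R v s))
            \<le> L * (exp (K * s) * dist (u s) (v s))"
          using lipschitz_onD[OF lip, of "exp (K * s) *\<^sub>R u s" "exp (K * s) *\<^sub>R v s"]
          by (simp add: dist_norm flip: scaleR_right_diff_distrib)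
        also have "\<dots> \<le> L * (exp (K * s) * dist u v)"
          using L by (intro mult_left_mono dist_bounded) auto
        finally show "norm (H (exp (K * s) *\<^sub>R u s) - H (exp (K * s) *\<^sub>R v s)) \<le> L * dist u v * exp (K * s)"
          by (simp add: mult_ac)
      qed (use L contH in \<open>auto intro!: continuous_intros\<close>)
      finally have "norm (I u ?t - I v ?t) \<le> L * dist u v * exp (K * ?t) / K" .
      then have "exp (- K * ?t) * norm (I u ?t - I v ?t) \<le> exp (- K * ?t) * (L * dist u v * exp (K * ?t) / K)"
        by (intro mult_left_mono) auto
      also have "\<dots> = L * dist u v / K"
        by (simp add: exp_minus field_simps)
      \<comment> \<open>\<open>K\<close> was chosen so that
        \<open>L / K \<le> 1 / 2\<close>.\<close>
      also have "\<dots> \<le> 1 / 2 * dist u v"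
        using K L mult_right_mono[of L "K/2" "dist u v"] by (simp add: K_def field_simps)
      also have "exp (- K * ?t) * norm (I u ?t - I v ?t) = norm (\<Phi> u t - \<Phi> v t)"
        by (simp add: \<Phi>_def flip: scaleR_right_diff_distrib)
      finally show "dist (Bcontfun (\<Phi> u) t) (Bcontfun (\<Phi> v) t) \<le> 1 / 2 * dist u v"
        by (simp add: app dist_norm)
    qed
  qed auto
  then obtain u where "Bcontfun (\<Phi> u) = u" by blast
  then have fix_u: "u t = \<Phi> u t" for t
    using app[of u] by simp
  define x where "x = (\<lambda>t. exp (K * t) *\<^sub>R u t)"
  have x_eq: "x t = y + I u t" if "t \<ge> 0" for t
    using that unfolding x_def fix_u[of t] by (simp add: \<Phi>_def max_absorb1 flip: exp_add)
  show thesis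
  proof
    show "x 0 = y" by (simp add: x_eq I_def)
    fix t :: real assume t: "t \<ge> 0"
    have "((\<lambda>t. y + I u t) has_vector_derivative H (x t)) (at t within {0..})"
      using has_vector_derivative_add[OF has_vector_derivative_const Ider[OF t]] by (simp add: x_def)
    then show "(x has_vector_derivative H (x t)) (at t within {0..})"
      by (rule has_vector_derivative_transform[rotated 2]) (use t x_eq in auto)
  qed
qed

section \<open>Uniqueness and continuous dependence for C1 fields\<close>

lemma C1_on_UNIV_lipschitz_on_cball:
  fixes f :: "'a::euclidean_space \<Rightarrow> 'b::real_normed_vector"
  assumes "C1_on UNIV f"
  obtains K where "K-lipschitz_on (cball 0 B) f"
  by (rule C1_on_lipschitz_on_compact[OF assms compact_cball[of 0 B] subset_UNIV])

lemma C1_on_UNIV_continuous: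
  fixes f :: "'a::euclidean_space \<Rightarrow> 'b::real_normed_vector"
  assumes "C1_on UNIV f"
  shows "isCont f x"
proof -
  obtain K where "K-lipschitz_on (cball 0 (norm x + 1)) f"
    by (rule C1_on_UNIV_lipschitz_on_cball[OF assms])
  then have "continuous_on (ball 0 (norm x + 1)) f"
    using continuous_on_subset[OF lipschitz_on_continuous_on ball_subset_cball] by blast
  then show ?thesis
    by (simp add: continuous_on_eq_continuous_at)
qed

lemma continuous_on_Icc_norm_bounded:
  fixes x :: "real \<Rightarrow> 'a::real_normed_vector"
  assumes "continuous_on {a..b} x"
  obtains B where "\<And>t. t \<in> {a..b} \<Longrightarrow> norm (x t) \<le> B"
proof -
  have "bounded (x ` {a..b})"
    using compact_imp_bounded[OF compact_continuous_image[OF assms compact_Icc]] .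
  then show thesis using that unfolding bounded_iff by blast
qed

text \<open>Both curves stay in one ball, on which \<open>f\<close> is Lipschitz, and the Gronwall
  estimate applies. The factor \<open>g\<close> admits equations in a changed time, with
  \<open>g\<close> the speed of the time change.\<close>

lemma C1_ode_unique:
  fixes f :: "'a::euclidean_space \<Rightarrow> 'a" and g :: "real \<Rightarrow> real"
  assumes f: "C1_on UNIV f" and g: "continuous_on {a..b} g" and "a \<le> b"
    and x: "\<And>t. t \<in> {a..b} \<Longrightarrow> (x has_vector_derivative g t *\<^sub>R f (x t)) (at t within {a..b})"
    and y: "\<And>t. t \<in> {a..b} \<Longrightarrow> (y has_vector_derivative g t *\<^sub>R f (y t)) (at t within {a..b})"
    and "x a = y a"
  shows "x b = y b"
proof -
  obtain Bx where Bx: "\<And>t. t \<in> {a..b} \<Longrightarrow> norm (x t) \<le> Bx"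
    using continuous_on_Icc_norm_bounded[OF continuous_on_vector_derivative[OF x]] by blast
  obtain By where By: "\<And>t. t \<in> {a..b} \<Longrightarrow> norm (y t) \<le> By"
    using continuous_on_Icc_norm_bounded[OF continuous_on_vector_derivative[OF y]] by blast
  obtain C where C: "\<And>t. t \<in> {a..b} \<Longrightarrow> norm (g t) \<le> C"
    using continuous_on_Icc_norm_bounded[OF g] by blast
  obtain K where K: "K-lipschitz_on (cball 0 (max Bx By)) f"
    by (rule C1_on_UNIV_lipschitz_on_cball[OF f])
  have "norm (x b - y b) \<le> exp (C * K * (b - a)) * norm (x a - y a)"
  proof (rule gronwall_dist[OF \<open>a \<le> b\<close> x y])
    fix t assume t: "t \<in> {a..b}"
    have "norm (g t *\<^sub>R f (x t) - g t *\<^sub>R f (y t)) = norm (g t) * norm (f (x t) - f (y t))"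
      by (simp flip: scaleR_right_diff_distrib)
    also have "\<dots> \<le> C * (K * norm (x t - y t))"
    proof (rule mult_mono[OF C[OF t]])
      show "norm (f (x t) - f (y t)) \<le> K * norm (x t - y t)"
        using lipschitz_onD[OF K, of "x t" "y t"] Bx[OF t] By[OF t] by (simp add: dist_norm)
      show "0 \<le> C" using C[OF t] norm_ge_zero[of "g t"] by linarith
    qed simp
    finally show "norm (g t *\<^sub>R f (x t) - g t *\<^sub>R f (y t)) \<le> C * K * norm (x t - y t)"
      by (simp add: mult.assoc)
  qed
  then show ?thesis using \<open>x a = y a\<close> by simp
qed

text \<open>A Lipschitz constant is available only on bounded sets, so \<open>y\<close> has to be
  confined first: while \<open>y\<close> is within distance 1 of \<open>x\<close>, both lie in the
  ball of radius \<open>B + 1\<close> and the Gronwall estimate holds; for a small initial distance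
  it prevents the distance 1 from ever being reached.\<close>

lemma C1_ode_continuous_dependence:
  fixes f :: "'a::euclidean_space \<Rightarrow> 'a"
  assumes f: "C1_on UNIV f" and "a \<le> b" and "0 < \<epsilon>"
    and x: "\<And>t. t \<in> {a..b} \<Longrightarrow> (x has_vector_derivative f (x t)) (at t within {a..b})"
  obtains \<delta> where "0 < \<delta>"
    "\<And>y. (\<And>t. t \<in> {a..b} \<Longrightarrow> (y has_vector_derivative f (y t)) (at t within {a..b})) \<Longrightarrow>
      dist (y a) (x a) < \<delta> \<Longrightarrow> dist (y b) (x b) < \<epsilon>"
proof -
  obtain B where B: "\<And>t. t \<in> {a..b} \<Longrightarrow> norm (x t) \<le> B"
    using continuous_on_Icc_norm_bounded[OF continuous_on_vector_derivative[OF x]] by blast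
  obtain K where K: "K-lipschitz_on (cball 0 (B + 1)) f"
    by (rule C1_on_UNIV_lipschitz_on_cball[OF f])
  have "K \<ge> 0" using K by (rule lipschitz_on_nonneg)
  define E where "E = exp (K * (b - a))"
  have gron: "dist (y s) (x s) \<le> E * dist (y a) (x a)"
    if "s \<in> {a..b}" "\<And>t. t \<in> {a..s} \<Longrightarrow> dist (y t) (x t) \<le> 1"
      and y: "\<And>t. t \<in> {a..b} \<Longrightarrow> (y has_vector_derivative f (y t)) (at t within {a..b})" for y s
  proof -
    have "norm (y s - x s) \<le> exp (K * (s - a)) * norm (y a - x a)"
    proof (rule gronwall_dist)
      fix t assume t: "t \<in> {a..s}"
      then have "t \<in> {a..b}" using that(1) by auto
      then show "(y has_vector_derivative f (y t)) (at t within {a..s})"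
        "(x has_vector_derivative f (x t)) (at t within {a..s})"
        using that(1) y x by (auto intro: has_vector_derivative_within_subset[where S = "{a..b}"])
      have "norm (y t) \<le> B + 1"
        using that(2)[OF t] B[OF \<open>t \<in> {a..b}\<close>] norm_triangle_sub[of "y t" "x t"] by (simp add: dist_norm)
      then show "norm (f (y t) - f (x t)) \<le> K * norm (y t - x t)"
        using lipschitz_onD[OF K, of "y t" "x t"] B[OF \<open>t \<in> {a..b}\<close>] by (simp add: dist_norm)
    qed (use that(1) in auto)
    also have "\<dots> \<le> E * norm (y a - x a)"
      unfolding E_def using that(1) \<open>K \<ge> 0\<close> by (intro mult_right_mono) (auto intro: mult_left_mono)
    finally show ?thesis by (simp add: dist_norm)
  qed
  \<comment> \<open>The 1 keeps the distance below 1 throughout, the \<open>\<epsilon>\<close> gives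
    the final estimate.\<close>
  define \<delta> where "\<delta> = min 1 \<epsilon> / E"
  have "E > 0" by (simp add: E_def)
  have E: "E * d < min 1 \<epsilon>" if "d < \<delta>" for d
    using that \<open>E > 0\<close> by (simp add: \<delta>_def field_simps)
  show thesis
  proof (rule that[of \<delta>])
    show "0 < \<delta>" using \<open>E > 0\<close> \<open>0 < \<epsilon>\<close> by (simp add: \<delta>_def)
    fix y assume y: "\<And>t. t \<in> {a..b} \<Longrightarrow> (y has_vector_derivative f (y t)) (at t within {a..b})"
      and d: "dist (y a) (x a) < \<delta>"
    have cont: "continuous_on {a..b} (\<lambda>t. dist (y t) (x t))"
      by (intro continuous_intros continuous_on_vector_derivative[OF x] continuous_on_vector_derivative[OF y])
    have "E \<ge> 1" using \<open>K \<ge> 0\<close> \<open>a \<le> b\<close> by (simp add: E_def)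
    then have "dist (y a) (x a) \<le> E * dist (y a) (x a)"
      using mult_right_mono[of 1 E "dist (y a) (x a)"] by simp
    then have "dist (y a) (x a) < 1" using E[OF d] by simp
    have le1: "dist (y t) (x t) < 1" if t: "t \<in> {a..b}" for t
    proof (rule ccontr)
      assume "\<not> ?thesis"
      then obtain s where s: "a < s" "s \<le> t" "dist (y s) (x s) = 1" "\<And>t. a \<le> t \<Longrightarrow> t < s \<Longrightarrow> dist (y t) (x t) < 1"
        using first_hitting[of a t "\<lambda>t. dist (y t) (x t)" 1] t continuous_on_subset[OF cont]
          \<open>dist (y a) (x a) < 1\<close> by auto
      then have "dist (y s) (x s) \<le> E * dist (y a) (x a)"
        using t by (intro gron y) (force simp: le_less)+
      then show False using E[OF d] s(3) by simp
    qed
    have "dist (y b) (x b) \<le> E * dist (y a) (x a)"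
      using \<open>a \<le> b\<close> le1 by (intro gron y) (auto intro: less_imp_le)
    then show "dist (y b) (x b) < \<epsilon>" using E[OF d] by simp
  qed
qed

lemma solves_ivp_derivative:
  "solves_ivp f t0 x0 T x \<Longrightarrow> t \<in> T \<Longrightarrow> S \<subseteq> T \<Longrightarrow> (x has_vector_derivative f (x t)) (at t within S)"
  by (auto simp: solves_ivp_def intro: has_vector_derivative_within_subset)

lemma solves_ivp_restrict:
  "solves_ivp f t0 x0 {t0..} x \<Longrightarrow> t0 \<le> t1 \<Longrightarrow> solves_ivp f t1 (x t1) {t1..} x"
  by (auto simp: solves_ivp_def intro: has_vector_derivative_within_subset[where S = "{t0..}"])

lemma C1_solves_ivp_unique:
  fixes f :: "'a::euclidean_space \<Rightarrow> 'a"
  assumes "C1_on UNIV f" "solves_ivp f t0 x0 {t0..} x" "solves_ivp f t0 x0 {t0..} y" "t0 \<le> t"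
  shows "x t = y t"
proof (rule C1_ode_unique[OF assms(1), of t0 t "\<lambda>_. 1"])
  fix s assume "s \<in> {t0..t}"
  then show "(x has_vector_derivative 1 *\<^sub>R f (x s)) (at s within {t0..t})"
    "(y has_vector_derivative 1 *\<^sub>R f (y s)) (at s within {t0..t})"
    using solves_ivp_derivative[OF assms(2)] solves_ivp_derivative[OF assms(3)] by auto
qed (use assms in \<open>auto simp: solves_ivp_def\<close>)

section \<open>The angular system\<close>

lemma Fs_inner_self: "y \<in> sphere 0 1 \<Longrightarrow> y \<bullet> Fs F y = 0"
  by (simp add: Fs_def Fr_def inner_diff_right inner_commute norm_eq_1)

text \<open>A single \<open>L\<close> serves as Lipschitz constant and as bound for both parts of
  the field, which keeps later estimates in one constant.\<close>

locale angular_field =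
  fixes F :: "real^'n \<Rightarrow> real^'n" and L :: real
  assumes Fr_lipschitz: "L-lipschitz_on (sphere 0 1) (Fr F)"
    and Fs_lipschitz: "L-lipschitz_on (sphere 0 1) (Fs F)"
    and Fr_bound: "y \<in> sphere 0 1 \<Longrightarrow> \<bar>Fr F y\<bar> \<le> L"
    and Fs_bound: "y \<in> sphere 0 1 \<Longrightarrow> norm (Fs F y) \<le> L"
    and L_pos: "0 < L"

text \<open>By the product rule for differences, a Lipschitz constant \<open>K\<close> and a bound
  \<open>M\<close> of \<open>F\<close> on the sphere give the constant \<open>M + K\<close> for
  \<open>Fr F\<close> and twice that for \<open>Fs F\<close>.\<close>

lemma C1_on_sphere_angular_field:
  fixes F :: "real^'n \<Rightarrow> real^'n"
  assumes "C1_on (sphere 0 1) F"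
  obtains L where "angular_field F L"
proof -
  obtain K where K: "K-lipschitz_on (sphere 0 1) F"
    by (rule C1_on_lipschitz_on_compact[OF assms compact_sphere order_refl])
  then have "K \<ge> 0" by (rule lipschitz_on_nonneg)
  have "compact (F ` sphere 0 1)"
    using lipschitz_on_continuous_on[OF K] by (intro compact_continuous_image) auto
  then have "bounded (F ` sphere 0 1)"
    by (rule compact_imp_bounded)
  then obtain M where "M > 0" "\<forall>z\<in>F ` sphere 0 1. norm z \<le> M"
    unfolding bounded_pos by auto
  then have M: "M > 0" "\<And>y. y \<in> sphere 0 1 \<Longrightarrow> norm (F y) \<le> M"
    by blast+
  have Fr_le: "\<bar>Fr F y\<bar> \<le> M" if "y \<in> sphere 0 1" for y
    using Cauchy_Schwarz_ineq2[of "F y" y] M(2)[OF that] that by (simp add: Fr_def)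
  have FK: "norm (F y - F z) \<le> K * norm (y - z)" if "y \<in> sphere 0 1" "z \<in> sphere 0 1" for y z
    using lipschitz_onD[OF K that] by (simp add: dist_norm)
  have Fr_diff: "\<bar>Fr F y - Fr F z\<bar> \<le> (M + K) * norm (y - z)"
    if "y \<in> sphere 0 1" "z \<in> sphere 0 1" for y z
  proof -
    have "Fr F y - Fr F z = F y \<bullet> (y - z) + (F y - F z) \<bullet> z"
      by (simp add: Fr_def inner_diff_left inner_diff_right)
    then have "\<bar>Fr F y - Fr F z\<bar> \<le> norm (F y) * norm (y - z) + norm (F y - F z) * norm z"
      using Cauchy_Schwarz_ineq2[of "F y" "y - z"] Cauchy_Schwarz_ineq2[of "F y - F z" z] by linarith
    also have "\<dots> \<le> M * norm (y - z) + K * norm (y - z)"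
      using that M FK[OF that] by (intro add_mono mult_right_mono) auto
    finally show ?thesis by (simp add: distrib_right)
  qed
  have Fs_diff: "norm (Fs F y - Fs F z) \<le> 2 * (M + K) * norm (y - z)"
    if "y \<in> sphere 0 1" "z \<in> sphere 0 1" for y z
  proof -
    have "Fs F y - Fs F z = (F y - F z) - (Fr F y *\<^sub>R (y - z) + (Fr F y - Fr F z) *\<^sub>R z)"
      by (simp add: Fs_def algebra_simps)
    then have "norm (Fs F y - Fs F z) = norm (F y - F z - (Fr F y *\<^sub>R (y - z) + (Fr F y - Fr F z) *\<^sub>R z))"
      by (simp only:)
    then have "norm (Fs F y - Fs F z) \<le> norm (F y - F z) +
        (norm (Fr F y *\<^sub>R (y - z)) + norm ((Fr F y - Fr F z) *\<^sub>R z))"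
      using norm_triangle_ineq4[of "F y - F z" "Fr F y *\<^sub>R (y - z) + (Fr F y - Fr F z) *\<^sub>R z"]
        norm_triangle_ineq[of "Fr F y *\<^sub>R (y - z)" "(Fr F y - Fr F z) *\<^sub>R z"] by linarith
    also have "\<dots> \<le> K * norm (y - z) + (M * norm (y - z) + (M + K) * norm (y - z))"
      using that FK[OF that] Fr_diff[OF that] Fr_le[OF that(1)]
      by (intro add_mono) (auto intro: mult_right_mono)
    finally show ?thesis by (simp add: algebra_simps)
  qed
  have "angular_field F (2 * (M + K))"
  proof
    show "(2 * (M + K))-lipschitz_on (sphere 0 1) (Fr F)"
    proof (rule lipschitz_onI)
      fix y z :: "real^'n" assume yz: "y \<in> sphere 0 1" "z \<in> sphere 0 1"
      have "0 \<le> (M + K) * norm (y - z)" using M \<open>K \<ge> 0\<close> by simp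
      then show "dist (Fr F y) (Fr F z) \<le> 2 * (M + K) * dist y z"
        using Fr_diff[OF yz] unfolding dist_norm real_norm_def mult.assoc by linarith
    qed (use M \<open>K \<ge> 0\<close> in auto)
    show "(2 * (M + K))-lipschitz_on (sphere 0 1) (Fs F)"
      by (rule lipschitz_onI) (use M \<open>K \<ge> 0\<close> Fs_diff in \<open>auto simp: dist_norm\<close>)
    fix y :: "real^'n" assume y: "y \<in> sphere 0 1"
    show "\<bar>Fr F y\<bar> \<le> 2 * (M + K)" using Fr_le[OF y] M \<open>K \<ge> 0\<close> by simp
    have "norm (Fs F y) \<le> norm (F y) + norm (Fr F y *\<^sub>R y)"
      unfolding Fs_def by (rule norm_triangle_ineq4)
    also have "\<dots> \<le> M + M" using y Fr_le[OF y] M(2)[OF y] by simp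
    finally show "norm (Fs F y) \<le> 2 * (M + K)" using \<open>K \<ge> 0\<close> by simp
  qed (use M \<open>K \<ge> 0\<close> in auto)
  then show thesis by (rule that)
qed

section \<open>Angular solutions and the radial integral\<close>

lemma sphere_solution_in_sphere: "sphere_solution F Y \<Longrightarrow> 0 \<le> S \<Longrightarrow> Y S \<in> sphere 0 1"
  by (simp add: sphere_solution_def)

lemma sphere_solution_norm: "sphere_solution F Y \<Longrightarrow> 0 \<le> S \<Longrightarrow> norm (Y S) = 1"
  by (simp add: sphere_solution_def)

lemma sphere_solution_derivative:
  "sphere_solution F Y \<Longrightarrow> 0 \<le> S \<Longrightarrow> (Y has_vector_derivative Fs F (Y S)) (at S within {0..})"
  by (simp add: sphere_solution_def solves_ivp_def)

lemma sphere_solution_continuous: "sphere_solution F Y \<Longrightarrow> continuous_on {0..} Y"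
  by (rule continuous_on_vector_derivative, rule sphere_solution_derivative) auto

lemma sphere_solution_shift:
  assumes Y: "sphere_solution F Y" and "0 \<le> s"
  shows "sphere_solution F (\<lambda>S. Y (s + S))"
  unfolding sphere_solution_def solves_ivp_def
proof (intro conjI allI impI ballI)
  fix S :: real assume S: "S \<in> {0..}"
  have "((\<lambda>S. s + S) has_vector_derivative 1) (at S within {0..})"
    by (auto intro!: derivative_eq_intros)
  moreover have "(Y has_vector_derivative Fs F (Y (s + S))) (at (s + S) within (\<lambda>S. s + S) ` {0..})"
    using sphere_solution_derivative[OF Y, of "s + S"] S \<open>0 \<le> s\<close>
    by (rule_tac has_vector_derivative_within_subset[where S = "{0..}"]) auto
  ultimately have "(Y \<circ> (\<lambda>S. s + S) has_vector_derivative 1 *\<^sub>R Fs F (Y (s + S))) (at S within {0..})"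
    by (rule vector_diff_chain_within)
  then show "((\<lambda>S. Y (s + S)) has_vector_derivative Fs F (Y (s + S))) (at S within {0..})"
    by (simp add: o_def)
qed (use sphere_solution_norm[OF Y] \<open>0 \<le> s\<close> in auto)

text \<open>The logarithm of the factor by which the radius changes: in angular time
  \<open>dR/dS = R * Fr F (Y S)\<close>.\<close>

definition radial_integral :: "(real^'n \<Rightarrow> real^'n) \<Rightarrow> (real \<Rightarrow> real^'n) \<Rightarrow> real \<Rightarrow> real" where
  "radial_integral F Y S = integral {0..S} (\<lambda>s. Fr F (Y s))"

lemma radial_integral_0 [simp]: "radial_integral F Y 0 = 0"
  by (simp add: radial_integral_def)

context angular_field
begin

lemma sphere_solution_exists:
  assumes y: "y \<in> sphere 0 1"
  obtains Y where "sphere_solution F Y" "Y 0 = y"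
proof -
  \<comment> \<open>The homogeneous extension of \<open>Fs F\<close> is globally Lipschitz and tangent to all spheres.\<close>
  define H where "H = (\<lambda>x. norm x *\<^sub>R Fs F (x /\<^sub>R norm x))"
  have unit: "x /\<^sub>R norm x \<in> sphere 0 1" if "x \<noteq> 0" for x :: "real^'n"
    using that by simp
  have Hn: "norm (H x) \<le> L * norm x" for x
    using Fs_bound[OF unit, of x] by (cases "x = 0") (auto simp: H_def mult.commute mult_right_mono)
  have "(3 * L)-lipschitz_on UNIV H"
  proof (rule lipschitz_onI)
    fix x y :: "real^'n"
    show "dist (H x) (H y) \<le> 3 * L * dist x y"
    proof (cases "x = 0 \<or> y = 0")
      case True
      have "norm (H x - H y) \<le> L * norm (x - y)"
        using True Hn[of x] Hn[of y] by (auto simp: H_def)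
      also have "\<dots> \<le> 3 * L * norm (x - y)" using L_pos by (intro mult_right_mono) auto
      finally show ?thesis by (simp add: dist_norm)
    next
      case False
      define u v where "u = x /\<^sub>R norm x" and "v = y /\<^sub>R norm y"
      have uv: "u \<in> sphere 0 1" "v \<in> sphere 0 1" "x = norm x *\<^sub>R u" "y = norm y *\<^sub>R v"
        using False by (auto simp: u_def v_def)
      \<comment> \<open>Directions alone vary arbitrarily fast near the origin; weighted by
        \<open>norm y\<close>, their difference is at most \<open>2 * norm (x - y)\<close>.\<close>
      have "norm y *\<^sub>R (u - v) = (norm y - norm x) *\<^sub>R u + (x - y)"
        using uv(3,4) by (simp add: algebra_simps)
      then have "norm (norm y *\<^sub>R (u - v)) \<le> norm ((norm y - norm x) *\<^sub>R u) + norm (x - y)"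
        by (metis norm_triangle_ineq)
      also have "\<dots> \<le> 2 * norm (x - y)"
        using uv(1) norm_triangle_ineq3[of x y] by (simp add: abs_minus_commute)
      finally have *: "norm y * norm (u - v) \<le> 2 * norm (x - y)" by simp
      have "norm (norm y *\<^sub>R (Fs F u - Fs F v)) \<le> norm y * (L * norm (u - v))"
        using lipschitz_onD[OF Fs_lipschitz uv(1,2)] by (simp add: dist_norm mult_left_mono)
      also have "\<dots> \<le> L * (2 * norm (x - y))"
        using mult_left_mono[OF *, of L] L_pos by (simp add: mult_ac)
      finally have 1: "norm (norm y *\<^sub>R (Fs F u - Fs F v)) \<le> 2 * L * norm (x - y)" by simp
      have "norm ((norm x - norm y) *\<^sub>R Fs F u) \<le> norm (x - y) * L"
        using norm_triangle_ineq3[of x y] Fs_bound[OF uv(1)] L_pos by (simp add: mult_mono)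
      moreover have "H x - H y = (norm x - norm y) *\<^sub>R Fs F u + norm y *\<^sub>R (Fs F u - Fs F v)"
        by (simp add: H_def u_def v_def algebra_simps)
      ultimately have "norm (H x - H y) \<le> norm (x - y) * L + 2 * L * norm (x - y)"
        using 1 norm_triangle_ineq by (smt (verit))
      then show ?thesis by (simp add: dist_norm algebra_simps)
    qed
  qed (use L_pos in auto)
  moreover have "H 0 = 0" by (simp add: H_def)
  ultimately obtain Y where Y: "Y 0 = y"
    "\<And>t. t \<ge> 0 \<Longrightarrow> (Y has_vector_derivative H (Y t)) (at t within {0..})"
    by (rule lipschitz_ode_exists[where y = y]) blast
  have orth: "x \<bullet> H x = 0" for x
  proof (cases "x = 0")
    case False
    then have "x \<bullet> H x = norm x * norm x * ((x /\<^sub>R norm x) \<bullet> Fs F (x /\<^sub>R norm x))"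
      by (simp add: H_def)
    then show ?thesis using Fs_inner_self[OF unit[OF False]] by simp
  qed simp
  \<comment> \<open>Tangency makes the norm constant, so the solution stays on the unit sphere,
    where \<open>H\<close> coincides with \<open>Fs F\<close>.\<close>
  have "\<exists>c. \<forall>t\<in>{0..}. Y t \<bullet> Y t = c"
  proof (rule has_vector_derivative_zero_constant)
    fix t :: real assume "t \<in> {0..}"
    then have "((\<lambda>t. Y t \<bullet> Y t) has_vector_derivative Y t \<bullet> H (Y t) + H (Y t) \<bullet> Y t) (at t within {0..})"
      using bounded_bilinear.has_vector_derivative[OF bounded_bilinear_inner Y(2) Y(2)] by simp
    then show "((\<lambda>t. Y t \<bullet> Y t) has_vector_derivative 0) (at t within {0..})"
      by (simp add: orth inner_commute[of "H _"])
  qed auto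
  then have nrm: "norm (Y t) = 1" if "t \<ge> 0" for t
    using that Y(1) y by (metis atLeast_iff mem_sphere_0 norm_eq_1 order_refl)
  then have "sphere_solution F Y"
    using Y by (auto simp: sphere_solution_def solves_ivp_def H_def)
  then show thesis using that Y(1) by blast
qed

lemma sphere_solution_dist:
  assumes Y: "sphere_solution F Y" and Z: "sphere_solution F Z" and S: "0 \<le> S"
  shows "dist (Y S) (Z S) \<le> exp (L * S) * dist (Y 0) (Z 0)"
proof -
  have "norm (Y S - Z S) \<le> exp (L * (S - 0)) * norm (Y 0 - Z 0)"
  proof (rule gronwall_dist[OF S])
    fix t assume t: "t \<in> {0..S}"
    show "(Y has_vector_derivative Fs F (Y t)) (at t within {0..S})"
      "(Z has_vector_derivative Fs F (Z t)) (at t within {0..S})"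
      using sphere_solution_derivative[OF Y] sphere_solution_derivative[OF Z] t
      by (auto intro: has_vector_derivative_within_subset[where S = "{0..}"])
    show "norm (Fs F (Y t) - Fs F (Z t)) \<le> L * norm (Y t - Z t)"
      using lipschitz_onD[OF Fs_lipschitz sphere_solution_in_sphere[OF Y] sphere_solution_in_sphere[OF Z], of t t] t
      by (simp add: dist_norm)
  qed
  then show ?thesis by (simp add: dist_norm)
qed

lemma Fr_continuous: "sphere_solution F Y \<Longrightarrow> A \<subseteq> {0..} \<Longrightarrow> continuous_on A (\<lambda>s. Fr F (Y s))"
  using lipschitz_on_continuous_on[OF Fr_lipschitz]
  by (rule continuous_on_compose2)
    (auto intro: continuous_on_subset[OF sphere_solution_continuous] dest: sphere_solution_norm)

lemma Fr_integrable: "sphere_solution F Y \<Longrightarrow> 0 \<le> a \<Longrightarrow> (\<lambda>s. Fr F (Y s)) integrable_on {a..b}"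
  by (intro integrable_continuous_real Fr_continuous) auto

lemma radial_integral_derivative:
  assumes "sphere_solution F Y" "0 \<le> S"
  shows "(radial_integral F Y has_real_derivative Fr F (Y S)) (at S within {0..})"
  using integral_has_vector_derivative_atLeast[OF Fr_continuous[OF assms(1) order_refl] assms(2)]
  by (simp add: has_real_derivative_iff_has_vector_derivative radial_integral_def[abs_def])

lemma radial_integral_continuous: "sphere_solution F Y \<Longrightarrow> continuous_on {0..} (radial_integral F Y)"
  by (rule DERIV_continuous_on, rule radial_integral_derivative) auto

lemma radial_integral_add:
  assumes Y: "sphere_solution F Y" and "0 \<le> s" "0 \<le> S"
  shows "radial_integral F Y (s + S) = radial_integral F Y s + radial_integral F (\<lambda>t. Y (s + t)) S"
proof -
  have "integral {0..s} (\<lambda>t. Fr F (Y t)) + integral {s..s + S} (\<lambda>t. Fr F (Y t)) = integral {0..s + S} (\<lambda>t. Fr F (Y t))"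
    using assms Fr_integrable[OF Y] by (intro Henstock_Kurzweil_Integration.integral_combine) auto
  moreover have "integral {s..s + S} (\<lambda>t. Fr F (Y t)) = integral {0..S} (\<lambda>t. Fr F (Y (s + t)))"
    using integral_shift_Icc_real[of 0 S "\<lambda>t. Fr F (Y t)" s] by (simp add: o_def add.commute)
  ultimately show ?thesis by (simp add: radial_integral_def)
qed

lemma radial_integral_bound:
  assumes Y: "sphere_solution F Y" and "0 \<le> S"
  shows "\<bar>radial_integral F Y S\<bar> \<le> L * S"
  using integral_bound[of 0 S "\<lambda>s. Fr F (Y s)" L] Fr_continuous[OF Y, of "{0..S}"] assms
    Fr_bound[OF sphere_solution_in_sphere[OF Y]]
  by (auto simp: radial_integral_def)

text \<open>The distance of the two solutions grows at most by \<open>exp (L * S)\<close>, and the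
  integrand is Lipschitz in it. Up to a fixed time the radial integral therefore depends
  continuously on the starting point.\<close>

lemma radial_integral_dist:
  assumes Y: "sphere_solution F Y" and Z: "sphere_solution F Z" and S: "0 \<le> S"
  shows "\<bar>radial_integral F Y S - radial_integral F Z S\<bar> \<le> L * exp (L * S) * S * dist (Y 0) (Z 0)"
proof -
  have "norm (integral {0..S} (\<lambda>s. Fr F (Y s) - Fr F (Z s))) \<le> L * exp (L * S) * dist (Y 0) (Z 0) * (S - 0)"
  proof (rule integral_bound[OF S])
    show "continuous_on {0..S} (\<lambda>s. Fr F (Y s) - Fr F (Z s))"
      by (intro continuous_intros Fr_continuous Y Z) auto
    fix s assume s: "s \<in> {0..S}"
    have "\<bar>Fr F (Y s) - Fr F (Z s)\<bar> \<le> L * dist (Y s) (Z s)"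
      using lipschitz_onD[OF Fr_lipschitz sphere_solution_in_sphere[OF Y] sphere_solution_in_sphere[OF Z], of s s] s
      by (simp add: dist_norm)
    also have "\<dots> \<le> L * (exp (L * s) * dist (Y 0) (Z 0))"
      using sphere_solution_dist[OF Y Z, of s] s L_pos by simp
    also have "\<dots> \<le> L * (exp (L * S) * dist (Y 0) (Z 0))"
      using s L_pos by (intro mult_left_mono mult_right_mono) auto
    finally show "norm (Fr F (Y s) - Fr F (Z s)) \<le> L * exp (L * S) * dist (Y 0) (Z 0)"
      by (simp add: mult_ac)
  qed
  then show ?thesis
    using Fr_integrable[OF Y, of 0 S] Fr_integrable[OF Z, of 0 S]
    by (simp add: radial_integral_def Henstock_Kurzweil_Integration.integral_diff mult_ac)
qed

section \<open>Attractors: stability and uniform radial growth\<close>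

lemma attractor_solution:
  assumes A: "attractor F A" and a: "a \<in> A"
  obtains Y where "sphere_solution F Y" "Y 0 = a" "\<And>S. 0 \<le> S \<Longrightarrow> Y S \<in> A"
proof -
  have inv: "flow_image F S A = A" if "0 \<le> S" for S
    using A that by (auto simp: attractor_def)
  have "a \<in> sphere 0 1" using A a by (auto simp: attractor_def)
  then obtain Y where Y: "sphere_solution F Y" "Y 0 = a"
    by (rule sphere_solution_exists)
  have "Y S \<in> A" if "0 \<le> S" for S
  proof -
    have "Y S \<in> flow_image F S A"
      unfolding flow_image_def using Y a by blast
    then show ?thesis using inv[OF that] by simp
  qed
  then show thesis using that Y by blast
qed

text \<open>A solution starting close to \<open>A\<close> needs a long time to leave it, so limits of exit
  points have backward orbits of arbitrary length in \<open>U0\<close> and hence lie in \<open>A\<close>.\<close>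
lemma attractor_stable:
  assumes A: "attractor F A" and "0 < \<epsilon>"
  obtains \<delta> where "0 < \<delta>"
    "\<And>Y S. sphere_solution F Y \<Longrightarrow> infdist (Y 0) A < \<delta> \<Longrightarrow> 0 \<le> S \<Longrightarrow> infdist (Y S) A < \<epsilon>"
proof -
  have A_props: "A \<noteq> {}" "compact A" "A \<subseteq> sphere 0 1" "closed A"
    using A by (auto simp: attractor_def compact_imp_closed)
  obtain U0 V where U0: "openin (top_of_set (sphere 0 1)) V" "A \<subseteq> V" "V \<subseteq> U0"
    "(\<Inter>S\<in>{0..}. flow_image F S U0) = A"
    using A unfolding attractor_def by blast
  obtain W where W: "open W" "V = sphere 0 1 \<inter> W"
    using U0(1) by (auto simp: openin_open)
  have "A \<subseteq> W" using W U0(2) by auto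
  then obtain \<epsilon>0 where \<epsilon>0: "\<epsilon>0 > 0" "{x. infdist x A \<le> \<epsilon>0} \<subseteq> W"
    using compact_in_open_separated[OF A_props(1,2) W(1)] by metis
  \<comment> \<open>Points of the sphere within distance \<open>e\<close> of \<open>A\<close> lie in
    \<open>U0\<close>, the neighbourhood whose flow images intersect in \<open>A\<close>.\<close>
  define e where "e = min \<epsilon> \<epsilon>0"
  have e: "0 < e" "e \<le> \<epsilon>"
    using \<epsilon>0 \<open>0 < \<epsilon>\<close> by (auto simp: e_def)
  have near: "x \<in> U0" if "x \<in> sphere 0 1" "infdist x A \<le> e" for x
    using \<epsilon>0 \<open>0 < \<epsilon>\<close> that W U0(3) by (auto simp: e_def)
  have "\<exists>\<delta>>0. \<forall>Y S. sphere_solution F Y \<and> infdist (Y 0) A < \<delta> \<and> 0 \<le> S \<longrightarrow> infdist (Y S) A < e"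
  proof (rule ccontr)
    assume neg: "\<not> ?thesis"
    have "\<exists>Y S. sphere_solution F Y \<and> infdist (Y 0) A < e / (real n + 2) \<and> 0 \<le> S \<and> e \<le> infdist (Y S) A" for n :: nat
    proof -
      have "0 < e / (real n + 2)" using e(1) by (intro divide_pos_pos) auto
      with neg have "\<not> (\<forall>Y S. sphere_solution F Y \<and> infdist (Y 0) A < e / (real n + 2) \<and> 0 \<le> S \<longrightarrow> infdist (Y S) A < e)"
        by blast
      then show ?thesis by (simp only: not_all not_imp not_less conj_assoc)
    qed
    then obtain Y S where YS: "\<And>n. sphere_solution F (Y n)" "\<And>n. infdist (Y n 0) A < e / (real n + 2)"
      "\<And>n. 0 \<le> S n" "\<And>n. e \<le> infdist (Y n (S n)) A"
      by metis
    have "\<exists>T. 0 \<le> T \<and> infdist (Y n T) A = e \<and> (\<forall>t. 0 \<le> t \<longrightarrow> t \<le> T \<longrightarrow> infdist (Y n t) A \<le> e)" for n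
    proof -
      have "e / (real n + 2) \<le> e" using e(1) by (simp add: field_simps)
      then have "infdist (Y n 0) A < e" using YS(2)[of n] by linarith
      moreover have "continuous_on {0..S n} (\<lambda>t. infdist (Y n t) A)"
        by (intro continuous_on_infdist continuous_on_subset[OF sphere_solution_continuous[OF YS(1)]]) auto
      ultimately obtain T where "0 < T" "infdist (Y n T) A = e" "\<And>t. 0 \<le> t \<Longrightarrow> t < T \<Longrightarrow> infdist (Y n t) A < e"
        using first_hitting[of 0 "S n" "\<lambda>t. infdist (Y n t) A" e] YS(3,4) by blast
      then show ?thesis by (intro exI[of _ T]) (force simp: le_less)
    qed
    then obtain T where T: "\<And>n. 0 \<le> T n" "\<And>n. infdist (Y n (T n)) A = e"
      "\<And>n t. 0 \<le> t \<Longrightarrow> t \<le> T n \<Longrightarrow> infdist (Y n t) A \<le> e"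
      by metis
    \<comment> \<open>A comparison solution starting at a point of \<open>A\<close> nearest to
      \<open>Y n 0\<close> stays in \<open>A\<close>. The distance between the two grows from less
      than \<open>e / (n + 2)\<close> to at least \<open>e\<close>, at exponential rate at most
      \<open>L\<close>.\<close>
    have T_large: "ln (real n + 2) \<le> L * T n" for n
    proof -
      obtain a where a: "a \<in> A" "infdist (Y n 0) A = dist (Y n 0) a"
        using infdist_attains_inf[OF A_props(4,1)] by metis
      obtain Z where Z: "sphere_solution F Z" "Z 0 = a" "\<And>S. 0 \<le> S \<Longrightarrow> Z S \<in> A"
        using attractor_solution[OF A a(1)] by blast
      have "e \<le> dist (Y n (T n)) (Z (T n))"
        using T(2)[of n] infdist_le[OF Z(3)[OF T(1)[of n]], of "Y n (T n)"] by simp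
      also have "\<dots> \<le> exp (L * T n) * dist (Y n 0) (Z 0)"
        by (rule sphere_solution_dist[OF YS(1) Z(1) T(1)])
      also have "\<dots> \<le> exp (L * T n) * (e / (real n + 2))"
        using YS(2)[of n] a Z(2) by (intro mult_left_mono) auto
      finally have "e * (real n + 2) \<le> e * exp (L * T n)"
        by (simp add: field_simps)
      then have "real n + 2 \<le> exp (L * T n)"
        using e(1) by (rule mult_left_le_imp_le)
      then show ?thesis using ln_le_cancel_iff[of "real n + 2" "exp (L * T n)"] by simp
    qed
    have "filterlim (\<lambda>n. L * T n) at_top sequentially"
    proof (rule filterlim_at_top_mono)
      show "filterlim (\<lambda>n. ln (real n + 2)) at_top sequentially"
        using filterlim_compose[OF ln_at_top
            filterlim_tendsto_add_at_top[OF tendsto_const filterlim_real_sequentially], of 2]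
        by (simp add: add.commute)
    qed (use T_large in auto)
    then have T_top: "\<forall>\<^sub>F n in sequentially. s \<le> T n" for s
      using L_pos by (auto simp: filterlim_at_top dest!: spec[of _ "L * s"])
    obtain z r where z: "strict_mono r" "(\<lambda>n. Y (r n) (T (r n))) \<longlonglongrightarrow> z" "z \<in> sphere 0 1"
    proof -
      have "\<forall>n. Y n (T n) \<in> sphere 0 1"
        using sphere_solution_in_sphere[OF YS(1) T(1)] by blast
      then show thesis
        using compact_sphere[of 0 1, unfolded compact_def] that by (force simp: o_def)
    qed
    have "infdist z A = e"
      using tendsto_infdist[OF z(2), of A] T(2) by (simp add: LIMSEQ_const_iff)
    have "z \<in> flow_image F s U0" if s: "0 \<le> s" for s
    proof -
      \<comment> \<open>The position \<open>s\<close> time units before the exit; the maximum with 0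
        matters only for the finitely many \<open>n\<close> with \<open>T (r n) < s\<close>. A limit
        point \<open>w\<close> lies in \<open>U0\<close>, and the solution from \<open>w\<close> is
        at \<open>z\<close> after time \<open>s\<close>.\<close>
      define v where "v = (\<lambda>n. Y (r n) (max 0 (T (r n) - s)))"
      have v: "v n \<in> sphere 0 1" "infdist (v n) A \<le> e" for n
        using sphere_solution_in_sphere[OF YS(1)] T(3) T(1) s by (auto simp: v_def max_def)
      obtain w q where w: "strict_mono q" "(\<lambda>n. v (q n)) \<longlonglongrightarrow> w" "w \<in> sphere 0 1"
        using compact_sphere[of 0 1, unfolded compact_def] v(1) by (force simp: o_def)
      have "infdist w A \<le> e"
        using LIMSEQ_le_const2[OF tendsto_infdist[OF w(2)]] v(2) by blast
      then have "w \<in> U0" using near w(3) by blast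
      obtain W where W: "sphere_solution F W" "W 0 = w"
        using sphere_solution_exists[OF w(3)] by blast
      have "\<forall>\<^sub>F n in sequentially. s \<le> T (r (q n))"
        using eventually_subseq[OF strict_mono_o[OF z(1) w(1)] T_top] by (simp add: o_def)
      then have ev: "\<forall>\<^sub>F n in sequentially. dist (Y (r (q n)) (T (r (q n)))) (W s) \<le> exp (L * s) * dist (v (q n)) w"
      proof eventually_elim
        case (elim n)
        let ?Y = "\<lambda>t. Y (r (q n)) ((T (r (q n)) - s) + t)"
        have "sphere_solution F ?Y"
          using sphere_solution_shift[OF YS(1)] elim by auto
        from sphere_solution_dist[OF this W(1) s] show ?case
          using elim by (simp add: v_def W(2))
      qed
      have "(\<lambda>n. exp (L * s) * dist (v (q n)) w) \<longlonglongrightarrow> exp (L * s) * dist w w"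
        by (intro tendsto_intros w(2))
      then have "(\<lambda>n. dist (Y (r (q n)) (T (r (q n)))) (W s)) \<longlonglongrightarrow> 0"
        using ev by (intro tendsto_sandwich[OF _ ev tendsto_const]) auto
      then have "(\<lambda>n. Y (r (q n)) (T (r (q n)))) \<longlonglongrightarrow> W s"
        by (rule tendsto_dist_iff[THEN iffD2])
      moreover have "(\<lambda>n. Y (r (q n)) (T (r (q n)))) \<longlonglongrightarrow> z"
        using LIMSEQ_subseq_LIMSEQ[OF z(2) w(1)] by (simp add: o_def)
      ultimately have "W s = z" by (rule LIMSEQ_unique)
      then show ?thesis unfolding flow_image_def using W \<open>w \<in> U0\<close> by blast
    qed
    then have "z \<in> A" using U0(4) by auto
    then show False using \<open>infdist z A = e\<close> e(1) by simp
  qed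
  then obtain \<delta> where "\<delta> > 0"
    "\<And>Y S. sphere_solution F Y \<Longrightarrow> infdist (Y 0) A < \<delta> \<Longrightarrow> 0 \<le> S \<Longrightarrow> infdist (Y S) A < e"
    by blast
  then show thesis using that[of \<delta>] e(2) by force
qed

text \<open>By contradiction and compactness: starting points of counterexamples accumulate at some
  \<open>a\<close> in \<open>A\<close>. The solution from \<open>a\<close> stays in
  \<open>A\<close>, hence starts in the basin, and the positive liminf yields a time
  \<open>S\<close> at which its radial integral exceeds \<open>c * S\<close>. Dependence on the
  starting point carries this over to the counterexamples. The bound \<open>1 \<le> S\<close> serves
  the iteration of the estimate.\<close>

lemma defocusing_radial_integral_ge_once:
  assumes A: "attractor F A" and def: "defocusing F A"
  obtains c \<delta> T where "0 < c" "0 < \<delta>"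
    "\<And>Y. sphere_solution F Y \<Longrightarrow> infdist (Y 0) A < \<delta> \<Longrightarrow> \<exists>S. 1 \<le> S \<and> S \<le> T \<and> c * S \<le> radial_integral F Y S"
proof -
  have A_props: "A \<noteq> {}" "compact A" "closed A"
    using A by (auto simp: attractor_def compact_imp_closed)
  \<comment> \<open>One index encodes all three constants: slope and neighbourhood are
    \<open>1 / (n + 1)\<close>, the time bound is \<open>n\<close>.\<close>
  have "\<exists>n::nat. \<forall>Y. sphere_solution F Y \<and> infdist (Y 0) A < inverse (real (Suc n)) \<longrightarrow>
     (\<exists>S. 1 \<le> S \<and> S \<le> real n \<and> inverse (real (Suc n)) * S \<le> radial_integral F Y S)"
  proof (rule ccontr)
    assume "\<not> ?thesis"
    then have "\<forall>n. \<exists>Y. sphere_solution F Y \<and> infdist (Y 0) A < inverse (real (Suc n)) \<and>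
      (\<forall>S. 1 \<le> S \<longrightarrow> S \<le> real n \<longrightarrow> radial_integral F Y S < inverse (real (Suc n)) * S)"
      by (simp only: not_ex not_all not_imp conj_assoc not_less[symmetric] de_Morgan_conj) blast
    then obtain Y where Y: "\<And>n. sphere_solution F (Y n)" "\<And>n. infdist (Y n 0) A < inverse (real (Suc n))"
      "\<And>n S. 1 \<le> S \<Longrightarrow> S \<le> real n \<Longrightarrow> radial_integral F (Y n) S < inverse (real (Suc n)) * S"
      by metis
    obtain a r where a: "strict_mono r" "(\<lambda>n. Y (r n) 0) \<longlonglongrightarrow> a"
    proof -
      have "\<forall>n. Y n 0 \<in> sphere 0 1"
        using sphere_solution_in_sphere[OF Y(1)] by blast
      then show thesis
        using compact_sphere[of 0 1, unfolded compact_def] that by (force simp: o_def)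
    qed
    have inv0: "(\<lambda>n. inverse (real (Suc (r n)))) \<longlonglongrightarrow> 0"
      using LIMSEQ_subseq_LIMSEQ[OF LIMSEQ_inverse_real_of_nat a(1)] by (simp add: o_def)
    have "infdist a A \<le> 0"
      by (rule LIMSEQ_le[OF tendsto_infdist[OF a(2)] inv0]) (use Y(2) less_imp_le in blast)
    then have "a \<in> A"
      using in_closed_iff_infdist_zero[OF A_props(3,1)] infdist_nonneg[of a A] by simp
    obtain Z where Z: "sphere_solution F Z" "Z 0 = a" "\<And>S. 0 \<le> S \<Longrightarrow> Z S \<in> A"
      using attractor_solution[OF A \<open>a \<in> A\<close>] by blast
    have "((\<lambda>S. infdist (Z S) A) \<longlongrightarrow> 0) at_top"
      by (intro tendsto_eventually eventually_mono[OF eventually_ge_at_top[of 0]]) (simp add: Z(3))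
    then have "Z 0 \<in> basin F A" using Z(1) unfolding basin_def by blast
    then have "0 < Liminf at_top (\<lambda>S. ereal (1 / S * radial_integral F Z S))"
      using def Z(1) unfolding defocusing_def radial_integral_def by blast
    then obtain b where b: "0 < b" "b < Liminf at_top (\<lambda>S. ereal (1 / S * radial_integral F Z S))"
      using dense by blast
    then obtain c where c: "b = ereal c" "0 < c"
      by (cases b) auto
    have "\<forall>\<^sub>F S in at_top. b < ereal (1 / S * radial_integral F Z S)"
      using less_LiminfD[OF b(2)] .
    then have "\<forall>\<^sub>F S in at_top. 1 \<le> S \<and> c < 1 / S * radial_integral F Z S"
      using eventually_ge_at_top[of 1] by eventually_elim (simp add: c)
    then obtain S where S: "1 \<le> S" "c < 1 / S * radial_integral F Z S"
      by (auto dest: eventually_happens)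
    then have cS: "c * S < radial_integral F Z S"
      by (simp add: field_simps)
    \<comment> \<open>The first summand bounds the radial integral of the counterexample, the second
      its deviation from that of \<open>Z\<close>; both vanish in the limit, while
      \<open>c * S\<close> is fixed.\<close>
    have "(\<lambda>n. inverse (real (Suc (r n))) * S + L * exp (L * S) * S * dist (Y (r n) 0) a) \<longlonglongrightarrow>
        0 * S + L * exp (L * S) * S * dist a a"
      by (intro tendsto_intros inv0 a(2))
    then have "\<forall>\<^sub>F n in sequentially. inverse (real (Suc (r n))) * S + L * exp (L * S) * S * dist (Y (r n) 0) a < c * S"
      using S(1) c(2) by (intro order_tendstoD(2)) auto
    moreover have "\<forall>\<^sub>F n in sequentially. S \<le> real (r n)"
      using filterlim_compose[OF filterlim_real_sequentially filterlim_subseq[OF a(1)]]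
      by (auto simp: filterlim_at_top)
    ultimately have "\<forall>\<^sub>F n in sequentially. False"
    proof eventually_elim
      case (elim n)
      have "\<bar>radial_integral F (Y (r n)) S - radial_integral F Z S\<bar> \<le> L * exp (L * S) * S * dist (Y (r n) 0) a"
        using radial_integral_dist[OF Y(1) Z(1), of S "r n"] S(1) Z(2) by simp
      then show False
        using elim Y(3)[OF S(1), of "r n"] cS by linarith
    qed
    then show False by simp
  qed
  then obtain n :: nat where "\<forall>Y. sphere_solution F Y \<and> infdist (Y 0) A < inverse (real (Suc n)) \<longrightarrow>
     (\<exists>S. 1 \<le> S \<and> S \<le> real n \<and> inverse (real (Suc n)) * S \<le> radial_integral F Y S)" ..
  then show thesis
    by (intro that[of "inverse (real (Suc n))" "inverse (real (Suc n))" "real n"]) auto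
qed

text \<open>Pieces of length between 1 and \<open>T\<close> with average at least \<open>c\<close>
  are concatenated; the last piece, of length at most \<open>T\<close>, loses at most
  \<open>(c + L) * T\<close> because \<open>Fr F\<close> is bounded by \<open>L\<close>. Since each
  piece has length at least 1, induction on an integer bound for \<open>S\<close>
  terminates.\<close>

lemma defocusing_radial_integral_ge:
  assumes A: "attractor F A" and def: "defocusing F A"
  obtains c \<delta> M where "0 < c" "0 < \<delta>"
    "\<And>Y S. sphere_solution F Y \<Longrightarrow> (\<And>s. 0 \<le> s \<Longrightarrow> infdist (Y s) A < \<delta>) \<Longrightarrow> 0 \<le> S \<Longrightarrow>
      c * S - M \<le> radial_integral F Y S"
proof -
  obtain c \<delta> T where c: "0 < c" "0 < \<delta>"
    and once: "\<And>Y. sphere_solution F Y \<Longrightarrow> infdist (Y 0) A < \<delta> \<Longrightarrow>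
      \<exists>S. 1 \<le> S \<and> S \<le> T \<and> c * S \<le> radial_integral F Y S"
    using defocusing_radial_integral_ge_once[OF assms] by blast
  have iter: "c * S - (c + L) * T \<le> radial_integral F Y S"
    if "S \<le> real n" "sphere_solution F Y" "\<And>s. 0 \<le> s \<Longrightarrow> infdist (Y s) A < \<delta>" "0 \<le> S" for Y S and n :: nat
    using that
  proof (induction n arbitrary: Y S)
    case 0
    \<comment> \<open>Here \<open>S = 0\<close>; the estimate is used only to see that
      \<open>T\<close> is positive.\<close>
    obtain s where "1 \<le> s" "s \<le> T" using once[OF 0(2) 0(3)] by auto
    then have "0 \<le> (c + L) * T" using c L_pos by simp
    then show ?case using 0 by simp
  next
    case (Suc n)
    obtain s where s: "1 \<le> s" "s \<le> T" "c * s \<le> radial_integral F Y s"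
      using once[OF Suc.prems(2) Suc.prems(3)] by auto
    show ?case
    proof (cases "S \<le> T")
      case True
      have "c * S - (c + L) * T \<le> - (L * S)"
        using True mult_left_mono[OF True, of "c + L"] c L_pos by (simp add: algebra_simps)
      then show ?thesis
        using radial_integral_bound[OF Suc.prems(2,4)] by linarith
    next
      case False
      have "c * (S - s) - (c + L) * T \<le> radial_integral F (\<lambda>t. Y (s + t)) (S - s)"
        using Suc.prems s False by (intro Suc.IH sphere_solution_shift) auto
      moreover have "radial_integral F Y S = radial_integral F Y s + radial_integral F (\<lambda>t. Y (s + t)) (S - s)"
        using radial_integral_add[OF Suc.prems(2), of s "S - s"] s False by simp
      ultimately show ?thesis using s(3) by (simp add: algebra_simps)
    qed
  qed
  show thesis
  proof (rule that[OF c, of "(c + L) * T"])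
    fix Y S assume *: "sphere_solution F Y" "\<And>s. 0 \<le> s \<Longrightarrow> infdist (Y s) A < \<delta>" "0 \<le> (S::real)"
    obtain n where "S \<le> real n" using real_arch_simple by blast
    then show "c * S - (c + L) * T \<le> radial_integral F Y S" using iter * by blast
  qed
qed

end

section \<open>The regularized problem in polar coordinates\<close>

lemma singular_field_scaleR:
  "0 < r \<Longrightarrow> norm y = 1 \<Longrightarrow> singular_field \<alpha> F (r *\<^sub>R y) = r powr \<alpha> *\<^sub>R F y"
  by (simp add: singular_field_def)

lemma regularized_field_1: "regularized_field \<alpha> F G 1 = rescaled_field \<alpha> F G"
  by (simp add: fun_eq_iff regularized_field_def rescaled_field_def)

lemma regularized_field_scaleR:
  assumes "0 < \<nu>"
  shows "regularized_field \<alpha> F G \<nu> (\<nu> *\<^sub>R x) = \<nu> powr \<alpha> *\<^sub>R rescaled_field \<alpha> F G x"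
proof -
  have dir: "(\<nu> *\<^sub>R x) /\<^sub>R norm (\<nu> *\<^sub>R x) = x /\<^sub>R norm x" "(\<nu> *\<^sub>R x) /\<^sub>R \<nu> = x"
    using assms by (simp_all add: field_simps)
  show ?thesis
    unfolding regularized_field_def rescaled_field_def singular_field_def dir
    using assms by (simp add: powr_mult)
qed

text \<open>On the sphere of radius \<open>\<nu>\<close> this is the matching condition between \<open>F\<close> and \<open>G\<close>,
  which is implied by continuity.\<close>
lemma regularized_field_eq_singular_field:
  fixes F G :: "real^'n \<Rightarrow> real^'n"
  assumes C1: "C1_on UNIV (regularized_field \<alpha> F G \<nu>)" and "0 < \<nu>" "\<nu> \<le> norm x"
  shows "regularized_field \<alpha> F G \<nu> x = singular_field \<alpha> F x"
proof (cases "\<nu> < norm x")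
  case False
  define y where "y = x /\<^sub>R norm x"
  have y: "norm y = 1" "x = \<nu> *\<^sub>R y" "norm x = \<nu>" using False assms by (auto simp: y_def)
  let ?f = "regularized_field \<alpha> F G \<nu>"
  have r: "((\<lambda>r. r) \<longlongrightarrow> \<nu>) (at_right \<nu>)" by (rule tendsto_ident_at)
  \<comment> \<open>The value on the sphere is found as the limit along the ray through
    \<open>y\<close> from outside, where the field is the singular one.\<close>
  have "((\<lambda>r. ?f (r *\<^sub>R y)) \<longlongrightarrow> ?f x) (at_right \<nu>)"
    by (rule isCont_tendsto_compose[OF C1_on_UNIV_continuous[OF C1]])
      (auto simp: y(2) intro!: tendsto_intros r)
  moreover have "((\<lambda>r. r powr \<alpha> *\<^sub>R F y) \<longlongrightarrow> \<nu> powr \<alpha> *\<^sub>R F y) (at_right \<nu>)"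
    using \<open>0 < \<nu>\<close> by (intro tendsto_intros r) auto
  then have "((\<lambda>r. ?f (r *\<^sub>R y)) \<longlongrightarrow> \<nu> powr \<alpha> *\<^sub>R F y) (at_right \<nu>)"
  proof (rule Lim_transform_eventually)
    show "\<forall>\<^sub>F r in at_right \<nu>. r powr \<alpha> *\<^sub>R F y = ?f (r *\<^sub>R y)"
      using eventually_at_right_less[of \<nu>]
    proof eventually_elim
      case (elim r)
      then show ?case
        using singular_field_scaleR[of r y \<alpha> F] \<open>0 < \<nu>\<close> y(1) by (simp add: regularized_field_def)
    qed
  qed
  ultimately have "?f x = \<nu> powr \<alpha> *\<^sub>R F y"
    using tendsto_unique trivial_limit_at_right_real by blast
  then show ?thesis using singular_field_scaleR[of \<nu> y \<alpha> F] \<open>0 < \<nu>\<close> y by simp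
qed (simp add: regularized_field_def)

text \<open>Lengths scale by \<open>\<nu>\<close> and field values by
  \<open>\<nu> powr \<alpha>\<close>, hence times by \<open>\<nu> powr (1 - \<alpha>)\<close>. The
  starting time \<open>\<tau>1\<close> is free because the equation is autonomous.\<close>

lemma rescaled_solution_of_regularized:
  fixes F G :: "real^'n \<Rightarrow> real^'n"
  assumes x: "solves_ivp (regularized_field \<alpha> F G \<nu>) t1 (\<nu> *\<^sub>R y) {t1..} x" and \<nu>: "0 < \<nu>"
  shows "solves_ivp (rescaled_field \<alpha> F G) \<tau>1 y {\<tau>1..}
    (\<lambda>\<tau>. x (t1 + \<nu> powr (1 - \<alpha>) * (\<tau> - \<tau>1)) /\<^sub>R \<nu>)"
  unfolding solves_ivp_def
proof (intro conjI ballI)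
  define c where "c = \<nu> powr (1 - \<alpha>)"
  have c: "c * \<nu> powr \<alpha> = \<nu>" "0 < c" using \<nu> by (auto simp: c_def simp flip: powr_add)
  define g where "g = (\<lambda>\<tau>. t1 + c * (\<tau> - \<tau>1))"
  show "x (t1 + \<nu> powr (1 - \<alpha>) * (\<tau>1 - \<tau>1)) /\<^sub>R \<nu> = y"
    using x \<nu> by (simp add: solves_ivp_def)
  fix \<tau> assume \<tau>: "\<tau> \<in> {\<tau>1..}"
  have "(g has_vector_derivative c) (at \<tau> within {\<tau>1..})"
    unfolding g_def by (auto intro!: derivative_eq_intros)
  moreover have "(x has_vector_derivative regularized_field \<alpha> F G \<nu> (x (g \<tau>))) (at (g \<tau>) within g ` {\<tau>1..})"
    using \<tau> c(2) by (intro solves_ivp_derivative[OF x]) (auto simp: g_def)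
  ultimately have "(x \<circ> g has_vector_derivative c *\<^sub>R regularized_field \<alpha> F G \<nu> (x (g \<tau>))) (at \<tau> within {\<tau>1..})"
    by (rule vector_diff_chain_within)
  from bounded_linear.has_vector_derivative[OF bounded_linear_scaleR_right[of "inverse \<nu>"] this]
  have "((\<lambda>\<tau>. x (g \<tau>) /\<^sub>R \<nu>) has_vector_derivative
      (c *\<^sub>R regularized_field \<alpha> F G \<nu> (x (g \<tau>))) /\<^sub>R \<nu>) (at \<tau> within {\<tau>1..})"
    by (simp add: o_def)
  also have "(c *\<^sub>R regularized_field \<alpha> F G \<nu> (x (g \<tau>))) /\<^sub>R \<nu> = rescaled_field \<alpha> F G (x (g \<tau>) /\<^sub>R \<nu>)"
    using regularized_field_scaleR[OF \<nu>, of \<alpha> F G "x (g \<tau>) /\<^sub>R \<nu>"] \<nu> c(1) by simp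
  finally show "((\<lambda>\<tau>. x (t1 + \<nu> powr (1 - \<alpha>) * (\<tau> - \<tau>1)) /\<^sub>R \<nu>) has_vector_derivative
      rescaled_field \<alpha> F G (x (t1 + \<nu> powr (1 - \<alpha>) * (\<tau> - \<tau>1)) /\<^sub>R \<nu>)) (at \<tau> within {\<tau>1..})"
    by (simp add: g_def c_def)
qed

section \<open>Radius and physical time along an angular solution\<close>

definition radius :: "(real^'n \<Rightarrow> real^'n) \<Rightarrow> real \<Rightarrow> (real \<Rightarrow> real^'n) \<Rightarrow> real \<Rightarrow> real" where
  "radius F r Y S = r * exp (radial_integral F Y S)"

text \<open>The direction moves with velocity \<open>R powr (\<alpha> - 1)\<close> times
  \<open>Fs F\<close> in physical time, so physical time passes at rate
  \<open>R powr (1 - \<alpha>)\<close> in angular time.\<close>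

definition elapsed :: "real \<Rightarrow> (real^'n \<Rightarrow> real^'n) \<Rightarrow> real \<Rightarrow> (real \<Rightarrow> real^'n) \<Rightarrow> real \<Rightarrow> real" where
  "elapsed \<alpha> F r Y S = integral {0..S} (\<lambda>s. radius F r Y s powr (1 - \<alpha>))"

lemma radius_0 [simp]: "radius F r Y 0 = r"
  by (simp add: radius_def)

lemma radius_pos: "0 < r \<Longrightarrow> 0 < radius F r Y S"
  by (simp add: radius_def)

lemma elapsed_0 [simp]: "elapsed \<alpha> F r Y 0 = 0"
  by (simp add: elapsed_def)

text \<open>No assumption on \<open>Y\<close> is made: the integral of a function that is not
  integrable is 0 by convention.\<close>

lemma elapsed_nonneg: "0 \<le> elapsed \<alpha> F r Y S"
  unfolding elapsed_def
  by (cases "(\<lambda>s. radius F r Y s powr (1 - \<alpha>)) integrable_on {0..S}")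
    (auto simp: not_integrable_integral intro: integral_nonneg)

locale regularization = angular_field F L for F :: "real^'n \<Rightarrow> real^'n" and L +
  fixes \<alpha> :: real and G :: "real^'n \<Rightarrow> real^'n"
  assumes \<alpha>_less_1: "\<alpha> < 1"
    and C1_regularized: "0 < \<nu> \<Longrightarrow> C1_on UNIV (regularized_field \<alpha> F G \<nu>)"
begin

lemma C1_rescaled: "C1_on UNIV (rescaled_field \<alpha> F G)"
  using C1_regularized[of 1] by (simp add: regularized_field_1)

lemma radius_derivative:
  assumes "sphere_solution F Y" "0 \<le> S"
  shows "(radius F r Y has_real_derivative radius F r Y S * Fr F (Y S)) (at S within {0..})"
  unfolding radius_def[abs_def]
  using DERIV_cmult[OF DERIV_chain2[OF DERIV_exp radial_integral_derivative[OF assms]], of r]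
  by (simp add: mult.assoc)

lemma radius_continuous: "sphere_solution F Y \<Longrightarrow> continuous_on {0..} (radius F r Y)"
  by (rule DERIV_continuous_on, rule radius_derivative) auto

text \<open>A positive continuous function has a positive minimum on a compact interval. This
  supplies a \<nu> for which the polar form is valid up to angular time \<open>S\<close>.\<close>

lemma radius_lower_bound:
  assumes "sphere_solution F Y" "0 < r"
  obtains m where "0 < m" "\<And>s. s \<in> {0..S} \<Longrightarrow> m \<le> radius F r Y s"
proof (cases "0 \<le> S")
  case True
  then have "\<exists>s\<in>{0..S}. \<forall>t\<in>{0..S}. radius F r Y s \<le> radius F r Y t"
    by (intro continuous_attains_inf continuous_on_subset[OF radius_continuous[OF assms(1)]]) auto
  then obtain s where "\<And>t. t \<in> {0..S} \<Longrightarrow> radius F r Y s \<le> radius F r Y t"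
    by blast
  then show thesis using that radius_pos[OF assms(2)] by blast
qed (use that[of 1] in auto)

lemma speed_continuous:
  assumes "sphere_solution F Y" "0 < r"
  shows "continuous_on {0..} (\<lambda>s. radius F r Y s powr (1 - \<alpha>))"
proof (intro continuous_on_powr radius_continuous assms continuous_on_const ballI)
  fix s show "radius F r Y s \<noteq> 0" using radius_pos[OF assms(2), of F Y s] by simp
qed

lemma elapsed_derivative:
  assumes "sphere_solution F Y" "0 < r" "0 \<le> S"
  shows "(elapsed \<alpha> F r Y has_real_derivative radius F r Y S powr (1 - \<alpha>)) (at S within {0..})"
  using integral_has_vector_derivative_atLeast[OF speed_continuous[OF assms(1,2)] assms(3)]
  by (simp add: has_real_derivative_iff_has_vector_derivative elapsed_def[abs_def])

lemma elapsed_continuous: "sphere_solution F Y \<Longrightarrow> 0 < r \<Longrightarrow> continuous_on {0..} (elapsed \<alpha> F r Y)"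
  by (rule DERIV_continuous_on, rule elapsed_derivative) auto

lemma elapsed_surj:
  assumes "sphere_solution F Y" "0 < r" "0 \<le> S" "0 \<le> h" "h \<le> elapsed \<alpha> F r Y S"
  obtains s where "0 \<le> s" "s \<le> S" "elapsed \<alpha> F r Y s = h"
  using IVT'[of "elapsed \<alpha> F r Y" 0 h S] assms
    continuous_on_subset[OF elapsed_continuous[OF assms(1,2)], of "{0..S}"] by auto

text \<open>Polar coordinates: both sides satisfy the same equation in the time \<open>s\<close> of \<open>Y\<close>, in which
  the regularized field is multiplied by the speed \<open>R powr (1 - \<alpha>)\<close>.\<close>
lemma regularized_solution_polar:
  assumes x: "solves_ivp (regularized_field \<alpha> F G \<nu>) t1 (r *\<^sub>R Y 0) {t1..} x"
    and Y: "sphere_solution F Y" and pos: "0 < \<nu>" "0 < r" "0 \<le> S"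
    and ge: "\<And>s. s \<in> {0..S} \<Longrightarrow> \<nu> \<le> radius F r Y s"
  shows "x (t1 + elapsed \<alpha> F r Y S) = radius F r Y S *\<^sub>R Y S"
proof -
  let ?f = "regularized_field \<alpha> F G \<nu>" and ?R = "radius F r Y"
  let ?e = "\<lambda>s. t1 + elapsed \<alpha> F r Y s"
  have "(x \<circ> ?e) S = (\<lambda>s. ?R s *\<^sub>R Y s) S"
  proof (rule C1_ode_unique[OF C1_regularized[OF pos(1)], where a = 0 and g = "\<lambda>s. ?R s powr (1 - \<alpha>)"])
    show "continuous_on {0..S} (\<lambda>s. ?R s powr (1 - \<alpha>))"
      by (rule continuous_on_subset[OF speed_continuous[OF Y pos(2)]]) auto
    show "0 \<le> S" by fact
    show "(x \<circ> ?e) 0 = ?R 0 *\<^sub>R Y 0" using x by (simp add: solves_ivp_def)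
    fix s assume s: "s \<in> {0..S}"
    have "(elapsed \<alpha> F r Y has_vector_derivative ?R s powr (1 - \<alpha>)) (at s within {0..})"
      using elapsed_derivative[OF Y pos(2), of s] s
      by (simp add: has_real_derivative_iff_has_vector_derivative)
    then have "(elapsed \<alpha> F r Y has_vector_derivative ?R s powr (1 - \<alpha>)) (at s within {0..S})"
      by (rule has_vector_derivative_within_subset) auto
    from has_vector_derivative_add[OF has_vector_derivative_const this, of t1]
    have "(?e has_vector_derivative ?R s powr (1 - \<alpha>)) (at s within {0..S})"
      by simp
    moreover have "(x has_vector_derivative ?f (x (?e s))) (at (?e s) within ?e ` {0..S})"
      by (rule solves_ivp_derivative[OF x]) (auto simp: elapsed_nonneg)
    ultimately have "(x \<circ> ?e has_vector_derivative ?R s powr (1 - \<alpha>) *\<^sub>R ?f (x (?e s))) (at s within {0..S})"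
      by (rule vector_diff_chain_within)
    then show "(x \<circ> ?e has_vector_derivative ?R s powr (1 - \<alpha>) *\<^sub>R ?f ((x \<circ> ?e) s)) (at s within {0..S})"
      by simp
    have R: "?R s > 0" by (rule radius_pos[OF pos(2)])
    have n: "norm (Y s) = 1" using sphere_solution_norm[OF Y] s by simp
    have "?f (?R s *\<^sub>R Y s) = singular_field \<alpha> F (?R s *\<^sub>R Y s)"
      using ge[OF s] R n by (intro regularized_field_eq_singular_field C1_regularized pos) auto
    also have "\<dots> = ?R s powr \<alpha> *\<^sub>R F (Y s)"
      by (rule singular_field_scaleR[OF R n])
    finally have "?R s powr (1 - \<alpha>) *\<^sub>R ?f (?R s *\<^sub>R Y s) = ?R s *\<^sub>R F (Y s)"
      using R by (simp flip: powr_add)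
    \<comment> \<open>The splitting into tangential and radial part is exactly the product rule for
      \<open>?R s *\<^sub>R Y s\<close>.\<close>
    also have "\<dots> = ?R s *\<^sub>R Fs F (Y s) + (?R s * Fr F (Y s)) *\<^sub>R Y s"
      by (simp add: Fs_def algebra_simps)
    finally have eq: "?R s powr (1 - \<alpha>) *\<^sub>R ?f (?R s *\<^sub>R Y s) = \<dots>" .
    have "((\<lambda>s. ?R s *\<^sub>R Y s) has_vector_derivative
        ?R s *\<^sub>R Fs F (Y s) + (?R s * Fr F (Y s)) *\<^sub>R Y s) (at s within {0..})"
      using s by (intro has_vector_derivative_scaleR radius_derivative sphere_solution_derivative Y) auto
    then show "((\<lambda>s. ?R s *\<^sub>R Y s) has_vector_derivative
        ?R s powr (1 - \<alpha>) *\<^sub>R ?f (?R s *\<^sub>R Y s)) (at s within {0..S})"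
      unfolding eq by (rule has_vector_derivative_within_subset) auto
  qed
  then show ?thesis by simp
qed

lemma elapsed_le_blowup_time:
  assumes x: "\<And>\<nu>. 0 < \<nu> \<Longrightarrow> solves_ivp (regularized_field \<alpha> F G \<nu>) t0 (r *\<^sub>R Y 0) {t0..} (x \<nu>)"
    and Y: "sphere_solution F Y" and "0 < r" "0 \<le> S"
    and tb: "is_blowup_time \<alpha> F t0 (r *\<^sub>R Y 0) tb"
  shows "t0 + elapsed \<alpha> F r Y S \<le> tb"
proof (rule ccontr)
  \<comment> \<open>A regularized solution with small \<open>\<nu>\<close> would continue the singular one beyond \<open>tb\<close>.\<close>
  define T where "T = t0 + elapsed \<alpha> F r Y S"
  assume "\<not> ?thesis"
  then have "tb < T" by (simp add: T_def)
  obtain \<nu> where \<nu>: "0 < \<nu>" "\<And>s. s \<in> {0..S} \<Longrightarrow> \<nu> \<le> radius F r Y s"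
    using radius_lower_bound[OF Y \<open>0 < r\<close>] by blast
  have ge: "\<nu> \<le> norm (x \<nu> t)" if t: "t \<in> {t0..<T}" for t
  proof -
    obtain s where s: "0 \<le> s" "s \<le> S" "elapsed \<alpha> F r Y s = t - t0"
      using elapsed_surj[OF Y \<open>0 < r\<close> \<open>0 \<le> S\<close>, of "t - t0"] t by (auto simp: T_def)
    have "x \<nu> (t0 + elapsed \<alpha> F r Y s) = radius F r Y s *\<^sub>R Y s"
      using s \<nu> by (intro regularized_solution_polar[OF x[OF \<nu>(1)] Y \<nu>(1) \<open>0 < r\<close>]) auto
    then have "norm (x \<nu> t) = radius F r Y s"
      using s sphere_solution_norm[OF Y s(1)] radius_pos[OF \<open>0 < r\<close>, of F Y s] by simp
    then show ?thesis using \<nu>(2)[of s] s by simp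
  qed
  have "nonzero_singular_solution \<alpha> F t0 (r *\<^sub>R Y 0) T (x \<nu>)"
    unfolding nonzero_singular_solution_def solves_ivp_def
  proof (intro conjI ballI)
    show "x \<nu> t0 = r *\<^sub>R Y 0" using x[OF \<nu>(1)] by (simp add: solves_ivp_def)
    fix t assume t: "t \<in> {t0..<T}"
    show "x \<nu> t \<noteq> 0" using ge[OF t] \<nu>(1) by auto
    show "(x \<nu> has_vector_derivative singular_field \<alpha> F (x \<nu> t)) (at t within {t0..<T})"
      using solves_ivp_derivative[OF x[OF \<nu>(1)], of t "{t0..<T}"] t
        regularized_field_eq_singular_field[OF C1_regularized[OF \<nu>(1)] \<nu>(1) ge[OF t]]
      by (simp add: subset_iff)
  qed
  then show False using tb \<open>tb < T\<close> unfolding is_blowup_time_def by blast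
qed

section \<open>Decay towards a focusing fixed point and entry into the ball of radius \<nu>\<close>

lemma radius_tendsto_0:
  assumes Y: "sphere_solution F Y" and lim: "(Y \<longlongrightarrow> p) at_top"
    and p: "p \<in> sphere 0 1" "Fr F p < 0"
  shows "(radius F r Y \<longlongrightarrow> 0) at_top"
proof -
  \<comment> \<open>Within distance \<open>k / L\<close> of \<open>p\<close> the value of
    \<open>Fr F\<close> differs from \<open>Fr F p\<close> by less than \<open>k\<close>, so it is
    at most \<open>- k\<close> and the radial integral decreases at least linearly.\<close>
  define k where "k = - Fr F p / 2"
  have "k > 0" using p by (simp add: k_def)
  have "\<forall>\<^sub>F S in at_top. dist (Y S) p < k / L \<and> 0 \<le> S"
    using tendstoD[OF lim, of "k / L"] eventually_ge_at_top[of 0] \<open>k > 0\<close> L_pos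
    by (intro eventually_conj) auto
  then obtain s where s: "\<And>S. s \<le> S \<Longrightarrow> dist (Y S) p < k / L \<and> 0 \<le> S"
    by (auto simp: eventually_at_top_linorder)
  have "0 \<le> s" using s by blast
  have Fr: "Fr F (Y S) \<le> - k" if "s \<le> S" for S
  proof -
    have "\<bar>Fr F (Y S) - Fr F p\<bar> \<le> L * dist (Y S) p"
      using lipschitz_onD[OF Fr_lipschitz sphere_solution_in_sphere[OF Y] p(1), of S] s[OF that]
      by (simp add: dist_norm)
    also have "\<dots> < k"
      using s[OF that] L_pos by (simp add: field_simps)
    finally show ?thesis by (simp add: k_def)
  qed
  have bound: "radial_integral F Y S \<le> radial_integral F Y s - k * (S - s)" if "s \<le> S" for S
  proof -
    have "(\<lambda>S. radial_integral F Y S + k * S) S \<le> (\<lambda>S. radial_integral F Y S + k * S) s"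
    proof (rule DERIV_nonpos_imp_decreasing_open[OF that])
      fix q assume q: "s < q" "q < S"
      then have "at q within {0..} = at q"
        using \<open>0 \<le> s\<close> by (intro at_within_open_subset[of q "{0<..}"]) auto
      then have "(radial_integral F Y has_real_derivative Fr F (Y q)) (at q)"
        using radial_integral_derivative[OF Y, of q] q \<open>0 \<le> s\<close> by simp
      then have "((\<lambda>S. radial_integral F Y S + k * S) has_real_derivative Fr F (Y q) + k) (at q)"
        by (auto intro!: derivative_eq_intros)
      then show "\<exists>y. ((\<lambda>S. radial_integral F Y S + k * S) has_real_derivative y) (at q) \<and> y \<le> 0"
        using Fr[of q] q by force
    next
      show "continuous_on {s..S} (\<lambda>S. radial_integral F Y S + k * S)"
        using \<open>0 \<le> s\<close>
        by (intro continuous_intros continuous_on_subset[OF radial_integral_continuous[OF Y]]) auto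
    qed
    then show ?thesis by (simp add: algebra_simps)
  qed
  have "filterlim (\<lambda>S. a - k * (S - s)) at_bot at_top" for a :: real
    using \<open>k > 0\<close> by real_asymp
  then have "filterlim (radial_integral F Y) at_bot at_top"
    by (rule filterlim_at_bot_mono) (use bound in \<open>auto simp: eventually_at_top_linorder\<close>)
  then have "((\<lambda>S. exp (radial_integral F Y S)) \<longlongrightarrow> 0) at_top"
    by (rule filterlim_compose[OF exp_at_bot])
  then show ?thesis
    unfolding radius_def[abs_def] by (rule tendsto_mult_right_zero)
qed

text \<open>From angular time \<open>S1\<close> on the direction is close to \<open>p\<close>. If
  \<nu> is below the minimum of the radius up to \<open>S1\<close>, the radius, which tends to 0,
  first reaches \<nu> after \<open>S1\<close>. Until then the solution has the polar form, and the
  physical time spent is bounded by the blowup time.\<close>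

lemma regularized_solution_enters:
  assumes x: "\<And>\<nu>. 0 < \<nu> \<Longrightarrow> solves_ivp (regularized_field \<alpha> F G \<nu>) t0 (r *\<^sub>R Y 0) {t0..} (x \<nu>)"
    and Y: "sphere_solution F Y" "(Y \<longlongrightarrow> p) at_top" and p: "p \<in> sphere 0 1" "Fr F p < 0"
    and "0 < r" "is_blowup_time \<alpha> F t0 (r *\<^sub>R Y 0) tb" "0 < \<delta>"
  obtains \<nu>0 where "0 < \<nu>0"
    "\<And>\<nu>. 0 < \<nu> \<Longrightarrow> \<nu> < \<nu>0 \<Longrightarrow> \<exists>te y. te \<le> tb \<and> y \<in> sphere 0 1 \<and> dist y p < \<delta> \<and>
      solves_ivp (regularized_field \<alpha> F G \<nu>) te (\<nu> *\<^sub>R y) {te..} (x \<nu>)"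
proof -
  obtain S1 where S1: "0 \<le> S1" "\<And>S. S1 \<le> S \<Longrightarrow> dist (Y S) p < \<delta>"
  proof -
    obtain q where "\<And>S. q \<le> S \<Longrightarrow> dist (Y S) p < \<delta>"
      using tendstoD[OF Y(2) \<open>0 < \<delta>\<close>] by (auto simp: eventually_at_top_linorder)
    then show thesis using that[of "max 0 q"] by simp
  qed
  obtain \<nu>0 where \<nu>0: "0 < \<nu>0" "\<And>s. s \<in> {0..S1} \<Longrightarrow> \<nu>0 \<le> radius F r Y s"
    using radius_lower_bound[OF Y(1) \<open>0 < r\<close>] by blast
  show thesis
  proof (rule that[OF \<nu>0(1)])
    fix \<nu> :: real assume \<nu>: "0 < \<nu>" "\<nu> < \<nu>0"
    have "\<forall>\<^sub>F S in at_top. radius F r Y S < \<nu> \<and> 0 \<le> S"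
      using order_tendstoD(2)[OF radius_tendsto_0[OF Y p] \<nu>(1)] eventually_ge_at_top
      by (intro eventually_conj) auto
    then obtain S2 where S2: "radius F r Y S2 < \<nu>" "0 \<le> S2"
      by (auto dest: eventually_happens)
    have "\<nu> < r" using \<nu>0(2)[of 0] S1(1) \<nu> by simp
    moreover have "continuous_on {0..S2} (\<lambda>S. - radius F r Y S)"
      by (intro continuous_intros continuous_on_subset[OF radius_continuous[OF Y(1)]]) auto
    \<comment> \<open>The radius is negated because \<open>first_hitting\<close> describes crossings
      from below.\<close>
    ultimately obtain s where s: "0 < s" "radius F r Y s = \<nu>" "\<And>t. 0 \<le> t \<Longrightarrow> t < s \<Longrightarrow> \<nu> < radius F r Y t"
      using first_hitting[of 0 S2 "\<lambda>S. - radius F r Y S" "- \<nu>"] S2 by auto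
    have "S1 \<le> s" using \<nu>0(2)[of s] s(1,2) \<nu> by force
    define te where "te = t0 + elapsed \<alpha> F r Y s"
    have "x \<nu> te = \<nu> *\<^sub>R Y s"
      unfolding te_def using s
      by (subst regularized_solution_polar[OF x[OF \<nu>(1)] Y(1) \<nu>(1) \<open>0 < r\<close>]) (auto simp: le_less)
    then have "solves_ivp (regularized_field \<alpha> F G \<nu>) te (\<nu> *\<^sub>R Y s) {te..} (x \<nu>)"
      using solves_ivp_restrict[OF x[OF \<nu>(1)], of te] by (simp add: te_def elapsed_nonneg)
    moreover have "te \<le> tb"
      unfolding te_def using x Y(1) \<open>0 < r\<close> s(1) assms(7)
      by (intro elapsed_le_blowup_time[where x = x]) auto
    ultimately show "\<exists>te y. te \<le> tb \<and> y \<in> sphere 0 1 \<and> dist y p < \<delta> \<and>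
        solves_ivp (regularized_field \<alpha> F G \<nu>) te (\<nu> *\<^sub>R y) {te..} (x \<nu>)"
      using S1(2)[OF \<open>S1 \<le> s\<close>] sphere_solution_in_sphere[OF Y(1), of s] s(1) by force
  qed
qed

section \<open>Growth along a defocusing attractor and escape of rescaled solutions\<close>

lemma elapsed_le_radius:
  assumes Y: "sphere_solution F Y" and "0 < r" "0 \<le> S" "0 < c"
    and ri: "\<And>s. 0 \<le> s \<Longrightarrow> s \<le> S \<Longrightarrow> c * (S - s) - M \<le> radial_integral F Y S - radial_integral F Y s"
  shows "elapsed \<alpha> F r Y S \<le> exp ((1 - \<alpha>) * M) / ((1 - \<alpha>) * c) * radius F r Y S powr (1 - \<alpha>)"
proof -
  define k where "k = (1 - \<alpha>) * c"
  have "k > 0" using \<alpha>_less_1 \<open>0 < c\<close> by (simp add: k_def)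
  \<comment> \<open>Seen backwards from \<open>S\<close>, the speed is at most \<open>D\<close>
    times a decaying exponential of rate \<open>k\<close>. Its integral is at most
    \<open>D / k\<close>, whatever the length of the interval.\<close>
  define D where "D = exp ((1 - \<alpha>) * M) * radius F r Y S powr (1 - \<alpha>)"
  have "D \<ge> 0" by (simp add: D_def)
  have int: "((\<lambda>s. D * exp (- (k * (S - s)))) has_integral
      (D * exp (- (k * (S - S))) / k - D * exp (- (k * (S - 0))) / k)) {0..S}"
    using \<open>k > 0\<close>
    by (intro fundamental_theorem_of_calculus \<open>0 \<le> S\<close>)
      (auto intro!: derivative_eq_intros simp flip: has_real_derivative_iff_has_vector_derivative)
  have "elapsed \<alpha> F r Y S \<le> integral {0..S} (\<lambda>s. D * exp (- (k * (S - s))))"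
    unfolding elapsed_def
  proof (rule integral_le)
    show "(\<lambda>s. radius F r Y s powr (1 - \<alpha>)) integrable_on {0..S}"
      by (intro integrable_continuous_real continuous_on_subset[OF speed_continuous[OF Y \<open>0 < r\<close>]]) auto
    show "(\<lambda>s. D * exp (- (k * (S - s)))) integrable_on {0..S}"
      using int by blast
    fix s assume "s \<in> {0..S}"
    then have s: "0 \<le> s" "s \<le> S" by auto
    have R: "radius F r Y q powr (1 - \<alpha>) = r powr (1 - \<alpha>) * exp ((1 - \<alpha>) * radial_integral F Y q)" for q
      using \<open>0 < r\<close> by (simp add: radius_def powr_def ln_mult distrib_left exp_add)
    have "(1 - \<alpha>) * (c * (S - s) - M) \<le> (1 - \<alpha>) * (radial_integral F Y S - radial_integral F Y s)"
      using ri[OF s] \<alpha>_less_1 by (intro mult_left_mono) auto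
    then have "(1 - \<alpha>) * radial_integral F Y s \<le> (1 - \<alpha>) * M + (1 - \<alpha>) * radial_integral F Y S + - (k * (S - s))"
      by (simp add: k_def algebra_simps)
    then have "exp ((1 - \<alpha>) * radial_integral F Y s) \<le>
        exp ((1 - \<alpha>) * M) * exp ((1 - \<alpha>) * radial_integral F Y S) * exp (- (k * (S - s)))"
      unfolding exp_add[symmetric] exp_le_cancel_iff .
    then have "r powr (1 - \<alpha>) * exp ((1 - \<alpha>) * radial_integral F Y s) \<le> r powr (1 - \<alpha>) *
        (exp ((1 - \<alpha>) * M) * exp ((1 - \<alpha>) * radial_integral F Y S) * exp (- (k * (S - s))))"
      by (intro mult_left_mono) auto
    then show "radius F r Y s powr (1 - \<alpha>) \<le> D * exp (- (k * (S - s)))"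
      unfolding D_def R by (simp only: mult_ac)
  qed
  also have "\<dots> \<le> D / k"
    unfolding integral_unique[OF int] using \<open>k > 0\<close> \<open>D \<ge> 0\<close> by simp
  finally show ?thesis by (simp add: D_def k_def)
qed

text \<open>A starting radius above \<open>exp \<bar>M\<bar>\<close> absorbs the loss
  \<open>M\<close> in the growth estimate, so the radius never falls below 1 and the polar form with
  \<nu> = 1 holds for all later times.\<close>

lemma rescaled_solution_expands:
  assumes X: "solves_ivp (rescaled_field \<alpha> F G) \<tau>1 z {\<tau>1..} X"
    and W: "sphere_solution F W" "z = norm z *\<^sub>R W 0" and "0 < c" and z: "exp \<bar>M\<bar> < norm z"
    and ri: "\<And>s S. 0 \<le> s \<Longrightarrow> s \<le> S \<Longrightarrow> c * (S - s) - M \<le> radial_integral F W S - radial_integral F W s"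
    and "\<tau>1 \<le> \<tau>"
  shows "\<exists>S\<ge>0. \<exists>R>0. X \<tau> = R *\<^sub>R W S \<and>
    \<tau> - \<tau>1 \<le> exp ((1 - \<alpha>) * M) / ((1 - \<alpha>) * c) * R powr (1 - \<alpha>)"
proof -
  let ?R = "radius F (norm z) W"
  have "0 < exp \<bar>M\<bar>" by simp
  with z have "0 < norm z" by linarith
  have R: "1 \<le> ?R s" if "0 \<le> s" for s
  proof -
    have "0 \<le> c * s" using that \<open>0 < c\<close> by simp
    then have "- \<bar>M\<bar> \<le> radial_integral F W s"
      using ri[OF order_refl that] by simp
    have "1 = exp \<bar>M\<bar> * exp (- \<bar>M\<bar>)" by (simp flip: exp_add)
    also have "\<dots> \<le> norm z * exp (radial_integral F W s)"
      using z \<open>- \<bar>M\<bar> \<le> radial_integral F W s\<close> by (intro mult_mono) auto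
    finally show ?thesis by (simp add: radius_def)
  qed
  define S0 where "S0 = \<tau> - \<tau>1"
  have "0 \<le> S0" using \<open>\<tau>1 \<le> \<tau>\<close> by (simp add: S0_def)
  \<comment> \<open>With radius at least 1 the speed is at least 1, so the required time
    \<open>\<tau> - \<tau>1\<close> has elapsed by an equal amount of angular time.\<close>
  have "integral {0..S0} (\<lambda>s. 1) \<le> elapsed \<alpha> F (norm z) W S0"
    unfolding elapsed_def
    by (intro integral_le integrable_continuous_real
        continuous_on_subset[OF speed_continuous[OF W(1) \<open>0 < norm z\<close>]] ge_one_powr_ge_zero)
      (use R \<alpha>_less_1 in auto)
  then have "S0 \<le> elapsed \<alpha> F (norm z) W S0" using \<open>0 \<le> S0\<close> by simp
  then obtain S where S: "0 \<le> S" "elapsed \<alpha> F (norm z) W S = S0"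
    using elapsed_surj[OF W(1) \<open>0 < norm z\<close> \<open>0 \<le> S0\<close> \<open>0 \<le> S0\<close>] by blast
  have "solves_ivp (regularized_field \<alpha> F G 1) \<tau>1 (norm z *\<^sub>R W 0) {\<tau>1..} X"
    using X W(2) by (simp add: regularized_field_1)
  then have "X (\<tau>1 + elapsed \<alpha> F (norm z) W S) = ?R S *\<^sub>R W S"
    by (rule regularized_solution_polar[OF _ W(1) zero_less_one \<open>0 < norm z\<close> S(1)]) (use R in auto)
  moreover have "elapsed \<alpha> F (norm z) W S \<le> exp ((1 - \<alpha>) * M) / ((1 - \<alpha>) * c) * ?R S powr (1 - \<alpha>)"
    by (rule elapsed_le_radius[OF W(1) \<open>0 < norm z\<close> S(1) \<open>0 < c\<close>]) (use ri in auto)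
  ultimately show ?thesis
    using S radius_pos[OF \<open>0 < norm z\<close>, of F W S] by (auto simp: S0_def)
qed

text \<open>After its escape an expelled solution does not meet the interior of the unit ball, so
  from the exit point on it follows the angular solution for every angular time
  \<open>S\<close>.\<close>

lemma expelled_polar:
  assumes "expelled_at \<alpha> F G ystar yent yesc" and Y: "sphere_solution F Y" "Y 0 = yesc" and "0 \<le> S"
  obtains X \<tau>1 where "rescaled_solution \<alpha> F G ystar yent X" "tau_ent \<alpha> F ystar \<le> \<tau>1"
    "X \<tau>1 = radius F 1 Y S *\<^sub>R Y S"
proof -
  obtain X \<tau>e where X: "rescaled_solution \<alpha> F G ystar yent X" "tau_ent \<alpha> F ystar < \<tau>e"
    "norm (X \<tau>e) = 1" "\<And>\<tau>. \<tau> > \<tau>e \<Longrightarrow> norm (X \<tau>) > 1" "yesc = X \<tau>e"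
    using assms(1) unfolding expelled_at_def by blast
  obtain m where m: "0 < m" "\<And>s. s \<in> {0..S} \<Longrightarrow> m \<le> radius F 1 Y s"
    using radius_lower_bound[OF Y(1) zero_less_one] by blast
  \<comment> \<open>It is not known in advance that the computed radius stays above 1; a \<nu> below
    its minimum on \<open>{0..S}\<close> makes the polar form applicable.\<close>
  define \<nu> where "\<nu> = min 1 m"
  have \<nu>: "0 < \<nu>" "\<nu> \<le> 1" "\<And>s. s \<in> {0..S} \<Longrightarrow> \<nu> \<le> radius F 1 Y s"
    using m by (auto simp: \<nu>_def min.coboundedI2)
  have X1: "solves_ivp (regularized_field \<alpha> F G 1) \<tau>e (X \<tau>e) {\<tau>e..} X"
    using X(1,2) unfolding rescaled_solution_def regularized_field_1
    by (intro solves_ivp_restrict) auto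
  \<comment> \<open>Outside the unit ball the fields for \<open>1\<close> and for \<open>\<nu>\<close> agree.\<close>
  have "solves_ivp (regularized_field \<alpha> F G \<nu>) \<tau>e (1 *\<^sub>R Y 0) {\<tau>e..} X"
    unfolding solves_ivp_def
  proof (intro conjI ballI)
    fix \<tau> assume \<tau>: "\<tau> \<in> {\<tau>e..}"
    then have "1 \<le> norm (X \<tau>)" using X(3,4) by (cases "\<tau> = \<tau>e") (auto intro: less_imp_le)
    then have "regularized_field \<alpha> F G \<nu> (X \<tau>) = regularized_field \<alpha> F G 1 (X \<tau>)"
      using \<nu> C1_regularized regularized_field_eq_singular_field[of \<alpha> F G _ "X \<tau>"] by auto
    then show "(X has_vector_derivative regularized_field \<alpha> F G \<nu> (X \<tau>)) (at \<tau> within {\<tau>e..})"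
      using X1 \<tau> by (simp add: solves_ivp_def)
  qed (use X(5) Y(2) in simp)
  then have "X (\<tau>e + elapsed \<alpha> F 1 Y S) = radius F 1 Y S *\<^sub>R Y S"
    by (rule regularized_solution_polar[OF _ Y(1) \<nu>(1) zero_less_one \<open>0 \<le> S\<close> \<nu>(3)])
  then show thesis
    using X(2) elapsed_nonneg[of \<alpha> F 1 Y S] by (intro that[OF X(1)]) auto
qed

text \<open>Defocusing fixes \<open>\<delta>0\<close> and stability of the attractor then
  \<open>\<delta>1\<close>. The reference solution from \<open>ystar\<close> is followed up to a
  time \<open>\<tau>1\<close> at which its direction is within \<open>\<delta>1\<close> of
  \<open>A\<close> and its radius exceeds \<open>exp \<bar>M\<bar>\<close>. Both conditions are
  open, so continuous dependence passes them to all solutions entering near \<open>ystar\<close>,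
  with common constants.\<close>

lemma rescaled_solution_escapes:
  assumes expelled: "expelled_at \<alpha> F G ystar ystar yesc"
    and A: "attractor F A" "defocusing F A" and basin: "yesc \<in> basin F A" and "0 < \<epsilon>"
  obtains \<delta> C \<tau>1 where "0 < \<delta>" "0 < C"
    "\<And>yent X \<tau>. rescaled_solution \<alpha> F G ystar yent X \<Longrightarrow> dist yent ystar < \<delta> \<Longrightarrow> \<tau>1 \<le> \<tau> \<Longrightarrow>
      X \<tau> \<noteq> 0 \<and> infdist (X \<tau> /\<^sub>R norm (X \<tau>)) A < \<epsilon> \<and> \<tau> - \<tau>1 \<le> C * norm (X \<tau>) powr (1 - \<alpha>)"
proof -
  obtain c \<delta>0 M where c: "0 < c" "0 < \<delta>0" and ge:
    "\<And>Y S. sphere_solution F Y \<Longrightarrow> (\<And>s. 0 \<le> s \<Longrightarrow> infdist (Y s) A < \<delta>0) \<Longrightarrow> 0 \<le> S \<Longrightarrow>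
      c * S - M \<le> radial_integral F Y S"
    using defocusing_radial_integral_ge[OF A] by blast
  obtain \<delta>1 where \<delta>1: "0 < \<delta>1" "\<And>Y S. sphere_solution F Y \<Longrightarrow> infdist (Y 0) A < \<delta>1 \<Longrightarrow> 0 \<le> S \<Longrightarrow>
      infdist (Y S) A < min \<epsilon> \<delta>0"
    using attractor_stable[OF A(1), of "min \<epsilon> \<delta>0"] c(2) \<open>0 < \<epsilon>\<close> by auto
  have ri: "c * (S - s) - M \<le> radial_integral F Y S - radial_integral F Y s"
    if Y: "sphere_solution F Y" and near: "infdist (Y 0) A < \<delta>1" and "0 \<le> s" "s \<le> S" for Y s S
  proof -
    have "c * (S - s) - M \<le> radial_integral F (\<lambda>t. Y (s + t)) (S - s)"
      using that \<delta>1(2)[OF Y near] by (intro ge sphere_solution_shift) auto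
    then show ?thesis
      using radial_integral_add[OF Y, of s "S - s"] that by simp
  qed
  obtain Y where Y: "sphere_solution F Y" "Y 0 = yesc" "((\<lambda>S. infdist (Y S) A) \<longlongrightarrow> 0) at_top"
    using basin unfolding basin_def by blast
  obtain S where S: "0 \<le> S" "infdist (Y S) A < \<delta>1" "exp \<bar>M\<bar> < radius F 1 Y S"
  proof -
    obtain S0 where S0: "0 \<le> S0" "\<And>S. S0 \<le> S \<Longrightarrow> infdist (Y S) A < \<delta>1"
    proof -
      obtain q where "\<And>S. q \<le> S \<Longrightarrow> infdist (Y S) A < \<delta>1"
        using order_tendstoD(2)[OF Y(3) \<delta>1(1)] by (auto simp: eventually_at_top_linorder)
      then show thesis using that[of "max 0 q"] by simp
    qed
    \<comment> \<open>\<open>N\<close> is the growth still needed after \<open>S0\<close> to bring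
      the radial integral above \<open>\<bar>M\<bar>\<close>: the summand \<open>M\<close> pays for
      the loss in the estimate, the 1 makes the inequality strict.\<close>
    define N where "N = \<bar>M\<bar> - radial_integral F Y S0 + M + 1"
    define S where "S = S0 + \<bar>N\<bar> / c"
    have "S0 \<le> S" using c by (simp add: S_def)
    have "c * (S - S0) - M \<le> radial_integral F (\<lambda>t. Y (S0 + t)) (S - S0) - radial_integral F (\<lambda>t. Y (S0 + t)) 0"
      using ri[OF sphere_solution_shift[OF Y(1) S0(1)], of 0 "S - S0"] S0 \<open>S0 \<le> S\<close> by simp
    moreover have "c * (S - S0) = \<bar>N\<bar>" using c by (simp add: S_def)
    ultimately have "\<bar>M\<bar> < radial_integral F Y S"
      using radial_integral_add[OF Y(1) S0(1), of "S - S0"] \<open>S0 \<le> S\<close> by (simp add: N_def)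
    then show thesis
      using that[of S] S0 \<open>S0 \<le> S\<close> by (simp add: radius_def)
  qed
  obtain X1 \<tau>1 where X1: "rescaled_solution \<alpha> F G ystar ystar X1" "tau_ent \<alpha> F ystar \<le> \<tau>1"
    "X1 \<tau>1 = radius F 1 Y S *\<^sub>R Y S"
    by (rule expelled_polar[OF expelled Y(1,2) S(1)])
  have X1_dir: "norm (X1 \<tau>1) = radius F 1 Y S" "X1 \<tau>1 /\<^sub>R norm (X1 \<tau>1) = Y S" "X1 \<tau>1 \<noteq> 0"
    using X1(3) sphere_solution_norm[OF Y(1) S(1)] radius_pos[OF zero_less_one, of F Y S] by auto
  have "((\<lambda>z. infdist (z /\<^sub>R norm z) A) \<longlongrightarrow> infdist (Y S) A) (nhds (X1 \<tau>1))"
    unfolding X1_dir(2)[symmetric]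
    by (intro tendsto_intros filterlim_ident) (use X1_dir(3) in auto)
  moreover have "((\<lambda>z. norm z) \<longlongrightarrow> radius F 1 Y S) (nhds (X1 \<tau>1))"
    unfolding X1_dir(1)[symmetric] by (intro tendsto_intros filterlim_ident)
  ultimately have "\<forall>\<^sub>F z in nhds (X1 \<tau>1). infdist (z /\<^sub>R norm z) A < \<delta>1 \<and> exp \<bar>M\<bar> < norm z"
    using S by (intro eventually_conj order_tendstoD)
  then obtain e where e: "0 < e" "\<And>z. dist z (X1 \<tau>1) < e \<Longrightarrow> infdist (z /\<^sub>R norm z) A < \<delta>1 \<and> exp \<bar>M\<bar> < norm z"
    unfolding eventually_nhds_metric by blast
  let ?f = "rescaled_field \<alpha> F G" and ?ent = "tau_ent \<alpha> F ystar"
  obtain \<delta> where \<delta>: "0 < \<delta>"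
    "\<And>X. (\<And>t. t \<in> {?ent..\<tau>1} \<Longrightarrow> (X has_vector_derivative ?f (X t)) (at t within {?ent..\<tau>1})) \<Longrightarrow>
      dist (X ?ent) (X1 ?ent) < \<delta> \<Longrightarrow> dist (X \<tau>1) (X1 \<tau>1) < e"
  proof (rule C1_ode_continuous_dependence[OF C1_rescaled X1(2) e(1)])
    fix t assume "t \<in> {?ent..\<tau>1}"
    then show "(X1 has_vector_derivative ?f (X1 t)) (at t within {?ent..\<tau>1})"
      using X1(1) unfolding rescaled_solution_def by (intro solves_ivp_derivative) auto
  qed blast
  define C where "C = exp ((1 - \<alpha>) * M) / ((1 - \<alpha>) * c)"
  have "0 < C" using c \<alpha>_less_1 by (simp add: C_def)
  show thesis
  proof (rule that[OF \<delta>(1) \<open>0 < C\<close>, of \<tau>1])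
    fix yent X \<tau>
    assume X: "rescaled_solution \<alpha> F G ystar yent X" and d: "dist yent ystar < \<delta>" and "\<tau>1 \<le> \<tau>"
    define z where "z = X \<tau>1"
    have "dist (X ?ent) (X1 ?ent) < \<delta>"
      using d X X1(1) by (simp add: rescaled_solution_def solves_ivp_def)
    then have "dist z (X1 \<tau>1) < e"
      unfolding z_def using X unfolding rescaled_solution_def
      by (intro \<delta>(2) solves_ivp_derivative) auto
    then have z: "infdist (z /\<^sub>R norm z) A < \<delta>1" "exp \<bar>M\<bar> < norm z" using e(2) by auto
    then have "z \<noteq> 0" by (metis exp_gt_zero less_trans norm_zero less_irrefl)
    then obtain W where W: "sphere_solution F W" "W 0 = z /\<^sub>R norm z"
      using sphere_solution_exists[of "z /\<^sub>R norm z"] by auto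
    have "solves_ivp ?f \<tau>1 z {\<tau>1..} X"
      using X X1(2) unfolding rescaled_solution_def z_def by (intro solves_ivp_restrict)
    then obtain S' R where R: "0 \<le> S'" "0 < R" "X \<tau> = R *\<^sub>R W S'" "\<tau> - \<tau>1 \<le> C * R powr (1 - \<alpha>)"
      using rescaled_solution_expands[OF _ W(1) _ c(1) z(2) ri[OF W(1)] \<open>\<tau>1 \<le> \<tau>\<close>] W(2) z(1) \<open>z \<noteq> 0\<close>
      unfolding C_def by force
    have "norm (W S') = 1" by (rule sphere_solution_norm[OF W(1) R(1)])
    then have "norm (X \<tau>) = R" "X \<tau> /\<^sub>R norm (X \<tau>) = W S'" "X \<tau> \<noteq> 0"
      using R(2,3) by auto
    moreover have "infdist (W S') A < \<epsilon>"
      using \<delta>1(2)[OF W(1) _ R(1)] W(2) z(1) by simp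
    ultimately show "X \<tau> \<noteq> 0 \<and> infdist (X \<tau> /\<^sub>R norm (X \<tau>)) A < \<epsilon> \<and> \<tau> - \<tau>1 \<le> C * norm (X \<tau>) powr (1 - \<alpha>)"
      using R(4) by simp
  qed
qed

end

section \<open>The limit of vanishing \<nu> for trapping and for expelling regularizations\<close>

theorem corollary1:
  fixes \<alpha> :: real
    and F G :: "real^'n \<Rightarrow> real^'n"
    and ystar y0 x0 :: "real^'n"
    and t0 r0 tb :: real
    and x\<nu> :: "real \<Rightarrow> real \<Rightarrow> real^'n"
  assumes "\<alpha> < 1"
    and "C1_on (sphere 0 1) F"
    and "\<And>\<nu>. \<nu> > 0 \<Longrightarrow> C1_on UNIV (regularized_field \<alpha> F G \<nu>)"
    and "ystar \<in> sphere 0 1" and "attractor F {ystar}" and "Fr F ystar < 0"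
    and "r0 > 0" and "y0 \<in> basin F {ystar}" and "x0 = r0 *\<^sub>R y0"
    and "\<And>\<nu>. \<nu> > 0 \<Longrightarrow> solves_ivp (regularized_field \<alpha> F G \<nu>) t0 x0 {t0..} (x\<nu> \<nu>)"
    and "is_blowup_time \<alpha> F t0 x0 tb"
  shows "(locally_trapping \<alpha> F G ystar \<longrightarrow> (\<forall>t>tb. ((\<lambda>\<nu>. x\<nu> \<nu> t) \<longlongrightarrow> 0) (at_right 0))) \<and>
    (locally_expelling \<alpha> F G ystar \<longrightarrow>
      (\<forall>t1 (\<nu>s :: nat \<Rightarrow> real) (x :: real \<Rightarrow> real^'n) ystar_esc A'.
        t1 > tb \<and> (\<forall>n. \<nu>s n > 0) \<and> \<nu>s \<longlonglongrightarrow> 0 \<and>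
        uniform_limit {tb..t1} (\<lambda>n. x\<nu> (\<nu>s n)) x sequentially \<and>
        expelled_at \<alpha> F G ystar ystar ystar_esc \<and>
        attractor F A' \<and> defocusing F A' \<and> ystar_esc \<in> basin F A' \<and>
        (\<exists>N. openin (top_of_set (sphere 0 1)) N \<and> ystar_esc \<in> N \<and>
          (\<forall>Y. sphere_solution F Y \<and> Y 0 \<in> N \<longrightarrow>
            Limsup at_top (\<lambda>S. ereal (integral {0..S} (\<lambda>S'.
              exp (- (1 - \<alpha>) * integral {S'..S} (\<lambda>S''. Fr F (Y S''))))) ) < \<infinity>))
        \<longrightarrow> (\<forall>t\<in>{tb<..t1}. norm (x t) > 0 \<and> x t /\<^sub>R norm (x t) \<in> A')))"
proof -
  obtain L where "angular_field F L"
    using C1_on_sphere_angular_field[OF assms(2)] by blast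
  then interpret regularization F L \<alpha> G
    using assms(1,3) by (intro regularization.intro regularization_axioms.intro)
  let ?ent = "tau_ent \<alpha> F ystar"
  obtain Y where Y: "sphere_solution F Y" "Y 0 = y0" "(Y \<longlongrightarrow> ystar) at_top"
    using assms(8) unfolding basin_def infdist_singleton tendsto_dist_iff[symmetric] by blast
  \<comment> \<open>\<open>te\<close> is the time of entry into the ball of radius \<nu>. The
    formula for \<open>x\<nu> \<nu> t\<close> inverts the rescaling that defines \<open>X\<close>,
    hence holds for all \<open>t\<close>; the equation for \<open>X\<close> concerns only times from
    \<open>?ent\<close> on, that is \<open>t \<ge> te\<close>.\<close>
  have entered: "\<exists>\<nu>0>0. \<forall>\<nu>. 0 < \<nu> \<longrightarrow> \<nu> < \<nu>0 \<longrightarrow> (\<exists>te y X. te \<le> tb \<and> y \<in> sphere 0 1 \<and>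
      dist y ystar < \<delta> \<and> rescaled_solution \<alpha> F G ystar y X \<and>
      (\<forall>t. x\<nu> \<nu> t = \<nu> *\<^sub>R X (?ent + (t - te) / \<nu> powr (1 - \<alpha>))))" if \<delta>: "0 < \<delta>" for \<delta>
  proof -
    obtain \<nu>0 where \<nu>0: "0 < \<nu>0"
      "\<And>\<nu>. 0 < \<nu> \<Longrightarrow> \<nu> < \<nu>0 \<Longrightarrow> \<exists>te y. te \<le> tb \<and> y \<in> sphere 0 1 \<and> dist y ystar < \<delta> \<and>
        solves_ivp (regularized_field \<alpha> F G \<nu>) te (\<nu> *\<^sub>R y) {te..} (x\<nu> \<nu>)"
    proof (rule regularized_solution_enters[where x = x\<nu>, OF _ Y(1,3) assms(4,6,7) _ \<delta>])
      fix \<nu> :: real assume "0 < \<nu>"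
      then show "solves_ivp (regularized_field \<alpha> F G \<nu>) t0 (r0 *\<^sub>R Y 0) {t0..} (x\<nu> \<nu>)"
        using assms(9,10) Y(2) by simp
    next
      show "is_blowup_time \<alpha> F t0 (r0 *\<^sub>R Y 0) tb" using assms(9,11) Y(2) by simp
    qed blast
    show ?thesis
    proof (rule exI[of _ \<nu>0], intro conjI allI impI \<nu>0(1))
      fix \<nu> :: real assume \<nu>: "0 < \<nu>" "\<nu> < \<nu>0"
      obtain te y where te: "te \<le> tb" "y \<in> sphere 0 1" "dist y ystar < \<delta>"
        "solves_ivp (regularized_field \<alpha> F G \<nu>) te (\<nu> *\<^sub>R y) {te..} (x\<nu> \<nu>)"
        using \<nu>0(2)[OF \<nu>] by blast
      define X where "X = (\<lambda>\<tau>. x\<nu> \<nu> (te + \<nu> powr (1 - \<alpha>) * (\<tau> - ?ent)) /\<^sub>R \<nu>)"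
      have "rescaled_solution \<alpha> F G ystar y X"
        unfolding rescaled_solution_def X_def by (rule rescaled_solution_of_regularized[OF te(4) \<nu>(1)])
      moreover have "\<forall>t. x\<nu> \<nu> t = \<nu> *\<^sub>R X (?ent + (t - te) / \<nu> powr (1 - \<alpha>))"
        using \<nu>(1) by (simp add: X_def)
      ultimately show "\<exists>te y X. te \<le> tb \<and> y \<in> sphere 0 1 \<and> dist y ystar < \<delta> \<and>
          rescaled_solution \<alpha> F G ystar y X \<and>
          (\<forall>t. x\<nu> \<nu> t = \<nu> *\<^sub>R X (?ent + (t - te) / \<nu> powr (1 - \<alpha>)))"
        using te(1-3) by blast
    qed
  qed
  show ?thesis
  proof (intro conjI impI allI ballI)
    fix t assume trap: "locally_trapping \<alpha> F G ystar" and t: "tb < t"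
    obtain V Rb where V: "openin (top_of_set (sphere 0 1)) V" "ystar \<in> V"
      and trapped: "\<And>y. y \<in> V \<Longrightarrow> trapped \<alpha> F G ystar y Rb"
      using trap unfolding locally_trapping_def by blast
    obtain \<delta> where \<delta>: "0 < \<delta>" "\<And>y. y \<in> sphere 0 1 \<Longrightarrow> dist y ystar < \<delta> \<Longrightarrow> y \<in> V"
      using V unfolding openin_euclidean_subtopology_iff by metis
    obtain \<nu>0 where \<nu>0: "0 < \<nu>0" and entered: "\<And>\<nu>. 0 < \<nu> \<Longrightarrow> \<nu> < \<nu>0 \<Longrightarrow>
      \<exists>te y X. te \<le> tb \<and> y \<in> sphere 0 1 \<and> dist y ystar < \<delta> \<and> rescaled_solution \<alpha> F G ystar y X \<and>
        (\<forall>t. x\<nu> \<nu> t = \<nu> *\<^sub>R X (?ent + (t - te) / \<nu> powr (1 - \<alpha>)))"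
      using entered[OF \<delta>(1)] by metis
    have "norm (x\<nu> \<nu> t) \<le> \<nu> * Rb" if \<nu>: "0 < \<nu>" "\<nu> < \<nu>0" for \<nu>
    proof -
      obtain te y X where te: "te \<le> tb" "y \<in> sphere 0 1" "dist y ystar < \<delta>" "rescaled_solution \<alpha> F G ystar y X"
        "x\<nu> \<nu> t = \<nu> *\<^sub>R X (?ent + (t - te) / \<nu> powr (1 - \<alpha>))"
        using entered[OF \<nu>] by blast
      let ?\<tau> = "?ent + (t - te) / \<nu> powr (1 - \<alpha>)"
      have "0 < (t - te) / \<nu> powr (1 - \<alpha>)"
        using te(1) t \<nu>(1) by (intro divide_pos_pos) auto
      then have \<tau>: "?ent < ?\<tau>" by linarith
      obtain X' where X': "rescaled_solution \<alpha> F G ystar y X'" "\<forall>\<tau>>?ent. norm (X' \<tau>) \<le> Rb"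
        using trapped[OF \<delta>(2)[OF te(2,3)]] unfolding trapped_def by blast
      \<comment> \<open>Trapping provides some rescaled solution with bound \<open>Rb\<close>; by
        uniqueness it is the one obtained from \<open>x\<nu> \<nu>\<close>.\<close>
      have "X ?\<tau> = X' ?\<tau>"
        using te(4) X'(1) \<tau> unfolding rescaled_solution_def
        by (intro C1_solves_ivp_unique[OF C1_rescaled]) auto
      then show ?thesis using te(5) X'(2) \<tau> \<nu>(1) by simp
    qed
    then have "\<forall>\<^sub>F \<nu> in at_right 0. norm (x\<nu> \<nu> t) \<le> \<nu> * Rb"
      using eventually_at_right_real[OF \<nu>0] by (auto elim!: eventually_mono)
    moreover have "((\<lambda>\<nu>. \<nu> * Rb) \<longlongrightarrow> 0) (at_right 0)"
      by (intro tendsto_mult_left_zero tendsto_ident_at)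
    ultimately show "((\<lambda>\<nu>. x\<nu> \<nu> t) \<longlongrightarrow> 0) (at_right 0)"
      by (rule Lim_null_comparison)
  next
    fix t1 and \<nu>s :: "nat \<Rightarrow> real" and x :: "real \<Rightarrow> real^'n" and ystar_esc A' and t :: real
    assume *: "t1 > tb \<and> (\<forall>n. \<nu>s n > 0) \<and> \<nu>s \<longlonglongrightarrow> 0 \<and>
        uniform_limit {tb..t1} (\<lambda>n. x\<nu> (\<nu>s n)) x sequentially \<and>
        expelled_at \<alpha> F G ystar ystar ystar_esc \<and>
        attractor F A' \<and> defocusing F A' \<and> ystar_esc \<in> basin F A' \<and>
        (\<exists>N. openin (top_of_set (sphere 0 1)) N \<and> ystar_esc \<in> N \<and>
          (\<forall>Y. sphere_solution F Y \<and> Y 0 \<in> N \<longrightarrow>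
            Limsup at_top (\<lambda>S. ereal (integral {0..S} (\<lambda>S'.
              exp (- (1 - \<alpha>) * integral {S'..S} (\<lambda>S''. Fr F (Y S''))))) ) < \<infinity>))"
      and t: "t \<in> {tb<..t1}"
    from * have \<nu>s: "\<And>n. \<nu>s n > 0" "\<nu>s \<longlonglongrightarrow> 0" and A': "attractor F A'" "defocusing F A'" "ystar_esc \<in> basin F A'"
      and expelled: "expelled_at \<alpha> F G ystar ystar ystar_esc"
      and unif: "uniform_limit {tb..t1} (\<lambda>n. x\<nu> (\<nu>s n)) x sequentially" by auto
    have lim: "(\<lambda>n. x\<nu> (\<nu>s n) t) \<longlonglongrightarrow> x t"
      using tendsto_uniform_limitI[OF unif] t by auto
    have main: "x t \<noteq> 0 \<and> infdist (x t /\<^sub>R norm (x t)) A' \<le> \<epsilon>" if \<epsilon>: "0 < \<epsilon>" for \<epsilon>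
    proof -
      obtain \<delta> C \<tau>1 where \<delta>: "0 < \<delta>" and C: "0 < C" and escape:
        "\<And>y X \<tau>. rescaled_solution \<alpha> F G ystar y X \<Longrightarrow> dist y ystar < \<delta> \<Longrightarrow> \<tau>1 \<le> \<tau> \<Longrightarrow>
          X \<tau> \<noteq> 0 \<and> infdist (X \<tau> /\<^sub>R norm (X \<tau>)) A' < \<epsilon> \<and> \<tau> - \<tau>1 \<le> C * norm (X \<tau>) powr (1 - \<alpha>)"
        using rescaled_solution_escapes[OF expelled A' \<epsilon>] by blast
      obtain \<nu>0 where \<nu>0: "0 < \<nu>0" and entered: "\<And>\<nu>. 0 < \<nu> \<Longrightarrow> \<nu> < \<nu>0 \<Longrightarrow>
        \<exists>te y X. te \<le> tb \<and> y \<in> sphere 0 1 \<and> dist y ystar < \<delta> \<and> rescaled_solution \<alpha> F G ystar y X \<and>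
          (\<forall>t. x\<nu> \<nu> t = \<nu> *\<^sub>R X (?ent + (t - te) / \<nu> powr (1 - \<alpha>)))"
        using entered[OF \<delta>] by metis
      \<comment> \<open>For large \<open>n\<close> the escape estimate, scaled back, leaves at least
        \<open>(t - tb) / 2 \<le> C * norm (x\<nu> (\<nu>s n) t) powr (1 - \<alpha>)\<close>. Thus
        \<open>q\<close> bounds this power of the norm from below, independently of
        \<open>n\<close>.\<close>
      define q where "q = (t - tb) / (2 * C)"
      have "q > 0" using t C by (simp add: q_def)
      \<comment> \<open>In physical time the rescaled stage between \<open>?ent\<close> and
        \<open>\<tau>1\<close> shrinks to nothing, since \<open>1 - \<alpha>\<close> is
        positive.\<close>
      have "(\<lambda>n. \<nu>s n powr (1 - \<alpha>) * (\<tau>1 - ?ent)) \<longlonglongrightarrow> 0"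
        using tendsto_powr'[OF \<nu>s(2) tendsto_const, of "1 - \<alpha>"] less_imp_le[OF \<nu>s(1)] \<alpha>_less_1
        by (intro tendsto_mult_left_zero) simp
      then have "\<forall>\<^sub>F n in sequentially. \<nu>s n powr (1 - \<alpha>) * (\<tau>1 - ?ent) < (t - tb) / 2"
        using t by (intro order_tendstoD(2)) auto
      moreover have "\<forall>\<^sub>F n in sequentially. \<nu>s n < \<nu>0"
        using \<nu>s(2) \<nu>0 by (rule order_tendstoD(2))
      ultimately have ev: "\<forall>\<^sub>F n in sequentially. q powr (1 / (1 - \<alpha>)) \<le> norm (x\<nu> (\<nu>s n) t) \<and>
          infdist (x\<nu> (\<nu>s n) t /\<^sub>R norm (x\<nu> (\<nu>s n) t)) A' \<le> \<epsilon>"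
      proof eventually_elim
        case (elim n)
        define p where "p = \<nu>s n powr (1 - \<alpha>)"
        have "p > 0" using \<nu>s(1)[of n] by (simp add: p_def)
        obtain te y X where te: "te \<le> tb" "dist y ystar < \<delta>" "rescaled_solution \<alpha> F G ystar y X"
          "x\<nu> (\<nu>s n) t = \<nu>s n *\<^sub>R X (?ent + (t - te) / p)"
          using entered[OF \<nu>s(1) elim(2)] unfolding p_def by blast
        define \<tau> where "\<tau> = ?ent + (t - te) / p"
        have "p * (\<tau> - \<tau>1) = (t - te) - p * (\<tau>1 - ?ent)"
          using \<open>p > 0\<close> by (simp add: \<tau>_def field_simps)
        moreover have "(t - tb) / 2 \<le> (t - te) - b" if "b < (t - tb) / 2" for b
          using that te(1) by (simp add: field_simps)
        ultimately have half: "(t - tb) / 2 \<le> p * (\<tau> - \<tau>1)"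
          using elim(1) unfolding p_def[symmetric] by simp
        then have "0 < p * (\<tau> - \<tau>1)" using t by simp
        then have "\<tau>1 \<le> \<tau>" using \<open>p > 0\<close> by (simp add: zero_less_mult_iff)
        note X = escape[OF te(3,2) this]
        then have "p * (\<tau> - \<tau>1) \<le> p * (C * norm (X \<tau>) powr (1 - \<alpha>))"
          using \<open>p > 0\<close> by (intro mult_left_mono) auto
        from order_trans[OF half this] have "(t - tb) / 2 \<le> C * (p * norm (X \<tau>) powr (1 - \<alpha>))"
          by (simp only: mult.left_commute)
        then have "q \<le> p * norm (X \<tau>) powr (1 - \<alpha>)"
          using C by (simp add: q_def field_simps)
        also have "\<dots> = norm (x\<nu> (\<nu>s n) t) powr (1 - \<alpha>)"
          using \<nu>s(1)[of n] by (simp add: te(4) p_def powr_mult flip: \<tau>_def[unfolded p_def])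
        finally have "q powr (1 / (1 - \<alpha>)) \<le> (norm (x\<nu> (\<nu>s n) t) powr (1 - \<alpha>)) powr (1 / (1 - \<alpha>))"
          using \<open>q > 0\<close> \<alpha>_less_1 by (intro powr_mono2) auto
        also have "\<dots> = norm (x\<nu> (\<nu>s n) t)"
          using \<alpha>_less_1 by (simp add: powr_powr)
        finally have 1: "q powr (1 / (1 - \<alpha>)) \<le> norm (x\<nu> (\<nu>s n) t)" .
        have "x\<nu> (\<nu>s n) t /\<^sub>R norm (x\<nu> (\<nu>s n) t) = X \<tau> /\<^sub>R norm (X \<tau>)"
          using \<nu>s(1)[of n] by (simp add: te(4) flip: \<tau>_def)
        then show ?case using 1 X by (simp add: less_imp_le)
      qed
      have "q powr (1 / (1 - \<alpha>)) \<le> norm (x t)"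
        by (rule tendsto_lowerbound[OF tendsto_norm[OF lim]])
          (use ev in \<open>auto elim: eventually_mono\<close>)
      moreover have "0 < q powr (1 / (1 - \<alpha>))" using \<open>q > 0\<close> by simp
      ultimately have "x t \<noteq> 0" by auto
      \<comment> \<open>The uniform lower bound on the norm is what makes the direction continuous
        at the limit.\<close>
      moreover have "(\<lambda>n. infdist (x\<nu> (\<nu>s n) t /\<^sub>R norm (x\<nu> (\<nu>s n) t)) A') \<longlonglongrightarrow> infdist (x t /\<^sub>R norm (x t)) A'"
        using \<open>x t \<noteq> 0\<close> by (intro tendsto_intros lim) auto
      then have "infdist (x t /\<^sub>R norm (x t)) A' \<le> \<epsilon>"
        by (rule tendsto_upperbound) (use ev in \<open>auto elim: eventually_mono\<close>)
      ultimately show ?thesis by blast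
    qed
    show "norm (x t) > 0" using main[of 1] by simp
    \<comment> \<open>The limit does not depend on \<open>\<epsilon>\<close>, which may therefore
      tend to 0; closedness of \<open>A'\<close> then gives membership.\<close>
    have "infdist (x t /\<^sub>R norm (x t)) A' \<le> 0"
      by (rule field_le_epsilon) (use main in auto)
    then have "infdist (x t /\<^sub>R norm (x t)) A' = 0" using infdist_nonneg by (rule antisym)
    moreover have "closed A'" "A' \<noteq> {}"
      using A'(1) by (auto simp: attractor_def compact_imp_closed)
    ultimately show "x t /\<^sub>R norm (x t) \<in> A'"
      using in_closed_iff_infdist_zero by blast
  qed
qed

end
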